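(* Let $p,k\ge1$ be integers, and let $f(V_1,\dots,V_k)$ be a real-valued function of $p\times p$ real positive definite matrices $V_1,\dots,V_k$ whose M-transform $$f^{*}(s_1,\dots,s_k)=\int_{V_1>O}\cdots\int_{V_k>O}|V_1|^{s_1-\frac{p+1}{2}}\cdots|V_k|^{s_k-\frac{p+1}{2}}f(V_1,\dots,V_k)\,{\rm d}V_1\wedge\cdots\wedge{\rm d}V_k$$ exists. For complex $\zeta_j,\alpha_j$ define the fractional integral operator of the second kind $$K_{U_1,\dots,U_k}^{(\zeta_j,\alpha_j),j=1,\dots,k}f(U_1,\dots,U_k)=\Big\{\prod_{j=1}^k\frac{|U_j|^{\zeta_j}}{\Gamma_p(\alpha_j)}\int_{V_j>U_j}|V_j|^{-\zeta_j-\alpha_j}|V_j-U_j|^{\alpha_j-\frac{p+1}{2}}\Big\}f(V_1,\dots,V_k)\,{\rm d}V_1\wedge\cdots\wedge{\rm d}V_k .$$ Then for $\Re(\alpha_j)>\frac{p-1}{2}$ and $\Re(\zeta_j+s_j)>\frac{p-1}{2}$, $j=1,\dots,k$, $$M\{K_{U_1,\dots,U_k}^{(\zeta_j,\alpha_j),j=1,\dots,k}f(U_1,\dots,U_k)\}(s_1,\dots,s_k)=f^{*}(s_1,\dots,s_k)\prod_{j=1}^k\frac{\Gamma_p(\zeta_j+s_j)}{\Gamma_p(\alpha_j+\zeta_j+s_j)},$$ where $M\{h\}(s_1,\dots,s_k)=\int_{U_1>O}\cdots\int_{U_k>O}\prod_{j=1}^k|U_j|^{s_j-\frac{p+1}{2}}h(U_1,\dots,U_k)\,{\rm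 d}U_1\wedge\cdots\wedge{\rm d}U_k$.
   Context: All matrices are real symmetric $p\times p$; $X>O$ means positive definite, $A<B$ means $B-A>O$. $|X|$ is the determinant and ${\rm d}X$ the wedge product of the differentials $dx_{ij}$, $i\ge j$. The real matrix-variate gamma function is $\Gamma_p(\alpha)=\pi^{p(p-1)/4}\Gamma(\alpha)\Gamma(\alpha-\frac12)\cdots\Gamma(\alpha-\frac{p-1}{2})$ for $\Re(\alpha)>\frac{p-1}{2}$. $K$ is the paper's generalized Kober fractional integral operator of the second kind in many matrix variables, and $M$ the M-transform. *)

theory Defs
  imports "HOL-Analysis.Analysis"
begin

text \<open>Real symmetric p x p matrices, p = CARD('n). A symmetric matrix is coordinatised
  by its independent entries x_ij (i >= j), indexed here by the unordered pairs {i,j}.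
  The measure dX (wedge product of the dx_ij, i >= j) is Lebesgue measure on these
  p(p+1)/2 coordinates.\<close>

definition sym_index :: "'n::finite set set" where
  "sym_index = {{i, j} | i j. True}"

definition sym_meas :: "('n::finite set \<Rightarrow> real) measure" where
  "sym_meas = PiM sym_index (\<lambda>_. lborel)"

definition symm :: "('n::finite set \<Rightarrow> real) \<Rightarrow> real^'n^'n" where
  "symm x = (\<chi> i j. x {i, j})"

definition posdef :: "real^'n^'n \<Rightarrow> bool" where
  "posdef A \<longleftrightarrow> (\<forall>v::real^'n. v \<noteq> 0 \<longrightarrow> v \<bullet> (A *v v) > 0)"

definition cpow :: "real \<Rightarrow> complex \<Rightarrow> complex" where
  "cpow d z = (complex_of_real d) powr z"

definition mgamma :: "nat \<Rightarrow> complex \<Rightarrow> complex" where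
  "mgamma p a = complex_of_real (pi powr (real p * (real p - 1) / 4)) *
      (\<Prod>i<p. Gamma (a - of_nat i / 2))"

definition multi_meas :: "nat \<Rightarrow> (nat \<Rightarrow> 'n::finite set \<Rightarrow> real) measure" where
  "multi_meas k = PiM {..<k} (\<lambda>_. sym_meas)"

definition multi_pos :: "nat \<Rightarrow> (nat \<Rightarrow> 'n::finite set \<Rightarrow> real) set" where
  "multi_pos k = {V \<in> space (multi_meas k). \<forall>j<k. posdef (symm (V j))}"

definition M_kernel :: "nat \<Rightarrow> (nat \<Rightarrow> complex) \<Rightarrow> (nat \<Rightarrow> 'n::finite set \<Rightarrow> real) \<Rightarrow> complex" where
  "M_kernel k s V = (\<Prod>j<k. cpow (det (symm (V j))) (s j - (of_nat CARD('n) + 1) / 2))"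

definition M_transform ::
  "nat \<Rightarrow> ((nat \<Rightarrow> 'n::finite set \<Rightarrow> real) \<Rightarrow> complex) \<Rightarrow> (nat \<Rightarrow> complex) \<Rightarrow> complex" where
  "M_transform k h s = (LINT V : multi_pos k | multi_meas k. M_kernel k s V * h V)"

definition kober2 ::
  "nat \<Rightarrow> (nat \<Rightarrow> complex) \<Rightarrow> (nat \<Rightarrow> complex) \<Rightarrow> ((nat \<Rightarrow> 'n::finite set \<Rightarrow> real) \<Rightarrow> real)
    \<Rightarrow> (nat \<Rightarrow> 'n set \<Rightarrow> real) \<Rightarrow> complex" where
  "kober2 k \<zeta> \<alpha> f U =
     (\<Prod>j<k. cpow (det (symm (U j))) (\<zeta> j) / mgamma CARD('n) (\<alpha> j)) *
     (LINT V : {V \<in> space (multi_meas k). \<forall>j<k. posdef (symm (V j) - symm (U j))} | multi_meas k.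
        (\<Prod>j<k. cpow (det (symm (V j))) (- \<zeta> j - \<alpha> j) *
                 cpow (det (symm (V j) - symm (U j))) (\<alpha> j - (of_nat CARD('n) + 1) / 2))
        * complex_of_real (f V))"

end

theory Submission
  imports Defs
begin

text \<open>After Fubini the theorem reduces to the type-1 beta integral over 0 < U < V of
  |U|^(a-(p+1)/2) |V-U|^(b-(p+1)/2) for a fixed positive definite V, with a = \<zeta> + s, b = \<alpha>.
  That integral is computed by induction on p without any matrix change of variables. Pivot U at
  one diagonal entry c, with u the rest of that row, and V at the entry d with row v. The
  determinants factor as c |U'| and (d-c) |V'-U'|, and after translating U' the induction
  hypothesis with a-1/2, b-1/2 integrates it out. The scalar identity
  u u^T/c + (v-u)(v-u)^T/(d-c) = v v^T/d + \<kappa> (u - (c/d)v)(u - (c/d)v)^T, \<kappa> = d/(c(d-c)),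
  leaves the integral over u of a power of |W - \<kappa> u u^T|, W the Schur complement of V,
  which yields to the same pivoting, and then a scalar beta integral in c.
  Absolute convergence comes for free: the absolute value of each integrand is the same integrand
  with every exponent replaced by its real part.\<close>

section \<open>Pivoting for symmetric matrices\<close>

text \<open>The usual substitution U = V^(1/2) Z V^(1/2) needs the Jacobian of a map on symmetric
  matrices. In coordinates, translations and affine substitutions in one real variable are enough.
  The dimension of a matrix type cannot shrink during an induction, so the induction runs over
  subsets \<open>S\<close> of one finite index type, with \<open>card S\<close> in the role of p.
  The bound Re a > (p-1)/2 is stable: when p drops by 1 and a by 1/2, both sides drop by 1/2.

  Indefinite upper bounds cannot be avoided. Once the pivot c and the row u are fixed, the upper
  bound for the remaining block is positive definite for some u only, yet the induction hypothesis
  is applied for every u.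

  In the final Fubini step, f is known only through its product with the M-kernel on the positive
  cone. That product is kept whole and the inverse kernel is put into a separate power of |V|; the
  power produced by the beta integral cancels exactly this factor and leaves the integrand of the
  M-transform.\<close>

definition posdef_on :: "'n set \<Rightarrow> ('n \<Rightarrow> 'n \<Rightarrow> real) \<Rightarrow> bool" where
  "posdef_on S X \<longleftrightarrow> (\<forall>v. (\<exists>i\<in>S. v i \<noteq> 0) \<longrightarrow> (\<Sum>i\<in>S. \<Sum>j\<in>S. v i * X i j * v j) > 0)"

text \<open>Padding by the identity turns every principal minor into a determinant of the one fixed
  matrix type; the empty minor becomes 1.\<close>

definition det_on :: "'n set \<Rightarrow> ('n::finite \<Rightarrow> 'n \<Rightarrow> real) \<Rightarrow> real" where
  "det_on S X = det ((\<chi> i j. if i \<in> S \<and> j \<in> S then X i j else if i = j then 1 else 0) :: real^'n^'n)"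

definition schur :: "'n \<Rightarrow> ('n \<Rightarrow> 'n \<Rightarrow> real) \<Rightarrow> 'n \<Rightarrow> 'n \<Rightarrow> real" where
  "schur t X = (\<lambda>i j. X i j - X i t * X t j / X t t)"

text \<open>One step of symmetric elimination: the padded matrix is L D L^T, where \<open>L\<close>
  is the identity plus \<open>l\<close> in column \<open>t\<close>, and \<open>D\<close> is the
  padded Schur complement \<open>E\<close> with row \<open>t\<close> scaled by the pivot.\<close>

lemma det_on_insert:
  fixes X :: "'n::finite \<Rightarrow> 'n \<Rightarrow> real"
  assumes t: "t \<notin> S" and sym: "\<And>i j. X i j = X j i" and nz: "X t t \<noteq> 0"
  shows "det_on (insert t S) X = X t t * det_on S (schur t X)"
proof -
  define l where "l = (\<lambda>i. if i \<in> S then X i t / X t t else 0)"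
  define L :: "real^'n^'n" where
    "L = (\<chi> i k. (if i = k then 1 else 0) + (if k = t then l i else 0))"
  define E :: "real^'n^'n" where
    "E = (\<chi> i j. if i \<in> S \<and> j \<in> S then schur t X i j else if i = j then 1 else 0)"
  define D :: "real^'n^'n" where
    "D = (\<chi> i. if i = t then X t t *s E $ i else E $ i)"
  have lt: "l t = 0" using t by (simp add: l_def)
  \<comment> \<open>Cramer's lemma for the identity: replacing column \<open>t\<close> by a vector
    gives that vector's entry at \<open>t\<close> as determinant, here 1.\<close>
  have "det L = det ((\<chi> i j. if j = t then ((mat 1 :: real^'n^'n) *v (\<chi> i. (if i = t then 1 else l i)))$i
                               else (mat 1 :: real^'n^'n)$i$j) :: real^'n^'n)"
    unfolding matrix_vector_mul_lid
    by (intro arg_cong[where f=det]) (auto simp: vec_eq_iff L_def mat_def lt)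
  then have detL: "det L = 1"
    by (simp only: cramer_lemma) simp
  have detD: "det D = X t t * det E"
    unfolding D_def by (subst det_row_mul) (auto intro!: arg_cong[where f=det] simp: vec_eq_iff)
  have Dt: "D $ t $ j = (if j = t then X t t else 0)" for j
    using t by (auto simp: D_def E_def)
  have Dt': "D $ i $ t = (if i = t then X t t else 0)" for i
    using t by (auto simp: D_def E_def)
  have LD: "(L ** D) $ i $ j = D $ i $ j + l i * D $ t $ j" for i j
  proof -
    have "(L ** D) $ i $ j = (\<Sum>k\<in>UNIV. (if i = k then D $ k $ j else 0) + (if k = t then l i * D $ k $ j else 0))"
      unfolding matrix_matrix_mult_def L_def by (simp, intro sum.cong) (auto simp: distrib_right)
    then show ?thesis by (simp add: sum.distrib)
  qed
  have LDL: "(A ** transpose L) $ i $ j = A $ i $ j + A $ i $ t * l j" for A :: "real^'n^'n" and i j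
  proof -
    have "(A ** transpose L) $ i $ j = (\<Sum>k\<in>UNIV. (if j = k then A $ i $ k else 0) + (if k = t then A $ i $ k * l j else 0))"
      unfolding matrix_matrix_mult_def transpose_def L_def
      by (simp, intro sum.cong) (auto simp: distrib_left)
    then show ?thesis by (simp add: sum.distrib)
  qed
  have "(L ** D ** transpose L) $ i $ j =
     (if i \<in> insert t S \<and> j \<in> insert t S then X i j else if i = j then 1 else 0)" for i j
  proof -
    have s: "X i t * X t j / X t t = X i t * X j t / X t t" using sym[of t j] by simp
    show ?thesis
      unfolding LDL LD Dt Dt' using t nz s sym[of t j]
      by (cases "i = t"; cases "j = t") (auto simp: D_def E_def l_def schur_def)
  qed
  then have "(\<chi> i j. if i \<in> insert t S \<and> j \<in> insert t S then X i j else if i = j then 1 else 0)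
      = L ** D ** transpose L"
    by (simp add: vec_eq_iff)
  then show ?thesis
    unfolding det_on_def by (simp add: det_mul detL detD E_def)
qed

text \<open>Completing the square in the coordinate \<open>v t\<close>.\<close>

lemma qform_insert:
  fixes X :: "'n \<Rightarrow> 'n \<Rightarrow> real"
  assumes "finite S" and t: "t \<notin> S" and sym: "\<And>i j. X i j = X j i" and nz: "X t t \<noteq> 0"
  shows "(\<Sum>i\<in>insert t S. \<Sum>j\<in>insert t S. v i * X i j * v j) =
    X t t * (v t + (\<Sum>i\<in>S. X t i * v i) / X t t)^2 + (\<Sum>i\<in>S. \<Sum>j\<in>S. v i * schur t X i j * v j)"
proof -
  let ?r = "\<Sum>i\<in>S. X t i * v i"
  let ?q = "\<Sum>i\<in>S. \<Sum>j\<in>S. v i * X i j * v j"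
  have r1: "(\<Sum>j\<in>S. v t * X t j * v j) = v t * ?r"
    by (simp add: sum_distrib_left mult_ac)
  have r2: "(\<Sum>i\<in>S. v i * X i t * v t) = v t * ?r"
    unfolding sum_distrib_left by (intro sum.cong refl) (metis mult.commute mult.left_commute sym)
  have "(\<Sum>i\<in>S. \<Sum>j\<in>S. v i * schur t X i j * v j)
      = ?q - (\<Sum>i\<in>S. \<Sum>j\<in>S. (X t i * v i) * (X t j * v j)) / X t t"
    unfolding schur_def sum_divide_distrib sum_subtractf[symmetric]
  proof (intro sum.cong refl)
    fix i j show "v i * (X i j - X i t * X t j / X t t) * v j =
        v i * X i j * v j - X t i * v i * (X t j * v j) / X t t"
      unfolding sym[of i t] by (simp add: algebra_simps)
  qed
  also have "(\<Sum>i\<in>S. \<Sum>j\<in>S. (X t i * v i) * (X t j * v j)) = ?r^2"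
    by (simp add: power2_eq_square sum_product)
  finally have s: "(\<Sum>i\<in>S. \<Sum>j\<in>S. v i * schur t X i j * v j) = ?q - ?r^2 / X t t" .
  have "(\<Sum>i\<in>insert t S. \<Sum>j\<in>insert t S. v i * X i j * v j)
     = X t t * (v t)^2 + 2 * v t * ?r + ?q"
    using \<open>finite S\<close> t by (simp add: sum.distrib r1 r2 power2_eq_square)
  also have "\<dots> = X t t * (v t + ?r / X t t)^2 + (?q - ?r^2 / X t t)"
    using nz by (simp add: power2_eq_square field_simps)
  finally show ?thesis unfolding s .
qed

text \<open>The completed square splits the form into the pivot times a square and the Schur form. A
  unit vector isolates the pivot; conversely, the two summands are nonnegative and cannot vanish
  together.\<close>

lemma posdef_on_insert:
  fixes X :: "'n \<Rightarrow> 'n \<Rightarrow> real"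
  assumes fin: "finite S" and t: "t \<notin> S" and sym: "\<And>i j. X i j = X j i"
  shows "posdef_on (insert t S) X \<longleftrightarrow> X t t > 0 \<and> posdef_on S (schur t X)"
proof (intro iffI conjI)
  assume P: "posdef_on (insert t S) X"
  let ?e = "\<lambda>i. if i = t then 1 else 0 :: real"
  have "(\<Sum>i\<in>insert t S. \<Sum>j\<in>insert t S. ?e i * X i j * ?e j) > 0"
    using P[unfolded posdef_on_def, rule_format, of ?e] by auto
  also have "(\<Sum>i\<in>insert t S. \<Sum>j\<in>insert t S. ?e i * X i j * ?e j)
     = (\<Sum>i\<in>insert t S. \<Sum>j\<in>insert t S. if j = t then (if i = t then X t t else 0) else 0)"
    by (intro sum.cong refl) auto
  also have "\<dots> = X t t" using fin by simp
  finally show pos: "X t t > 0" .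
  show "posdef_on S (schur t X)"
    unfolding posdef_on_def
  proof (intro allI impI)
    fix v :: "'n \<Rightarrow> real" assume v: "\<exists>i\<in>S. v i \<noteq> 0"
    \<comment> \<open>This entry at \<open>t\<close> makes the completed square vanish, so only the
      Schur form is left.\<close>
    define w where "w = v(t := - (\<Sum>i\<in>S. X t i * v i) / X t t)"
    have wS: "w i = v i" if "i \<in> S" for i using that t by (auto simp: w_def)
    have sw: "(\<Sum>i\<in>S. X t i * w i) = (\<Sum>i\<in>S. X t i * v i)"
      by (intro sum.cong refl) (simp add: wS)
    have "(\<Sum>i\<in>insert t S. \<Sum>j\<in>insert t S. w i * X i j * w j) > 0"
      using P[unfolded posdef_on_def, rule_format, of w] v wS by force
    also have "(\<Sum>i\<in>insert t S. \<Sum>j\<in>insert t S. w i * X i j * w j)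
        = (\<Sum>i\<in>S. \<Sum>j\<in>S. w i * schur t X i j * w j)"
      using pos by (subst qform_insert[OF fin t sym]) (auto simp: sw, simp add: w_def)
    also have "\<dots> = (\<Sum>i\<in>S. \<Sum>j\<in>S. v i * schur t X i j * v j)"
      by (intro sum.cong refl) (simp add: wS)
    finally show "(\<Sum>i\<in>S. \<Sum>j\<in>S. v i * schur t X i j * v j) > 0" .
  qed
next
  assume A: "X t t > 0 \<and> posdef_on S (schur t X)"
  then have pos: "X t t > 0" by simp
  show "posdef_on (insert t S) X"
    unfolding posdef_on_def
  proof (intro allI impI)
    fix v :: "'n \<Rightarrow> real" assume v: "\<exists>i\<in>insert t S. v i \<noteq> 0"
    show "(\<Sum>i\<in>insert t S. \<Sum>j\<in>insert t S. v i * X i j * v j) > 0"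
    proof (cases "\<exists>i\<in>S. v i \<noteq> 0")
      case True
      then have "(\<Sum>i\<in>S. \<Sum>j\<in>S. v i * schur t X i j * v j) > 0"
        using A by (simp add: posdef_on_def)
      then show ?thesis
        using pos by (subst qform_insert[OF fin t sym]) (auto intro!: add_nonneg_pos)
    next
      case False
      then have "v t \<noteq> 0" using v by auto
      with False pos show ?thesis
        by (subst qform_insert[OF fin t sym]) auto
    qed
  qed
qed

lemma schur_sym:
  assumes "\<And>i j. X i j = X j i"
  shows "schur t X i j = schur t X j i"
  unfolding schur_def using assms[of i j] assms[of i t] assms[of t j] by simp

lemma posdef_on_cong:
  assumes "\<And>i j. i \<in> S \<Longrightarrow> j \<in> S \<Longrightarrow> X i j = Y i j"
  shows "posdef_on S X = posdef_on S Y"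
  using assms by (simp add: posdef_on_def)

lemma det_on_cong:
  fixes X :: "'n::finite \<Rightarrow> 'n \<Rightarrow> real"
  assumes "\<And>i j. i \<in> S \<Longrightarrow> j \<in> S \<Longrightarrow> X i j = Y i j"
  shows "det_on S X = det_on S Y"
  unfolding det_on_def using assms by (intro arg_cong[where f=det]) (simp add: vec_eq_iff)

lemma posdef_on_add:
  assumes "posdef_on S X" "posdef_on S Y"
  shows "posdef_on S (\<lambda>i j. X i j + Y i j)"
  using assms unfolding posdef_on_def by (simp add: algebra_simps sum.distrib add_pos_pos)

lemma det_on_empty: "det_on {} X = 1"
  unfolding det_on_def using det_I by (simp add: mat_def)

lemma det_on_pos:
  fixes X :: "'n::finite \<Rightarrow> 'n \<Rightarrow> real"
  assumes "\<And>i j. X i j = X j i" "posdef_on S X"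
  shows "det_on S X > 0"
  using finite[of S] assms
proof (induction S arbitrary: X rule: finite_induct)
  case empty
  then show ?case by (simp add: det_on_empty)
next
  case (insert t S)
  then have *: "X t t > 0" "posdef_on S (schur t X)"
    using posdef_on_insert[of S t X] by auto
  have "det_on S (schur t X) > 0"
    by (intro insert.IH schur_sym insert.prems *)
  then show ?case
    using * insert by (subst det_on_insert) auto
qed

lemma posdef_on_UNIV: "posdef_on UNIV (\<lambda>i j. A $ i $ j) \<longleftrightarrow> posdef (A :: real^'n^'n)"
proof -
  have *: "v \<bullet> (A *v v) = (\<Sum>i\<in>UNIV. \<Sum>j\<in>UNIV. v $ i * A $ i $ j * v $ j)" for v :: "real^'n"
    by (simp add: inner_vec_def matrix_vector_mult_def sum_distrib_left mult_ac)
  show ?thesis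
  proof
    assume "posdef_on UNIV (\<lambda>i j. A $ i $ j)"
    then show "posdef A"
      unfolding posdef_def * posdef_on_def by (auto simp: vec_eq_iff)
  next
    assume P: "posdef A"
    show "posdef_on UNIV (\<lambda>i j. A $ i $ j)"
      unfolding posdef_on_def
    proof (intro allI impI)
      fix v :: "'n \<Rightarrow> real" assume "\<exists>i\<in>UNIV. v i \<noteq> 0"
      then have "(\<chi> i. v i) \<noteq> (0 :: real^'n)" by (auto simp: vec_eq_iff)
      from P[unfolded posdef_def, rule_format, OF this, unfolded *]
      show "(\<Sum>i\<in>UNIV. \<Sum>j\<in>UNIV. v i * A $ i $ j * v j) > 0" by simp
    qed
  qed
qed

lemma det_on_UNIV: "det_on UNIV (\<lambda>i j. A $ i $ j) = det A"
  by (simp add: det_on_def)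

section \<open>Powers of determinants, extended by zero\<close>

text \<open>Extending the powers by 0 off the positive cone turns the domain 0 < U < V into a plain
  product of two factors, and lets formulas hold for indefinite V as well, where both sides vanish.\<close>

definition pos_powr :: "real \<Rightarrow> complex \<Rightarrow> complex" where
  "pos_powr x z = (if x > 0 then cpow x z else 0)"

definition det_powr_on :: "'n set \<Rightarrow> ('n::finite \<Rightarrow> 'n \<Rightarrow> real) \<Rightarrow> complex \<Rightarrow> complex" where
  "det_powr_on S X z = (if posdef_on S X then cpow (det_on S X) z else 0)"

lemma cpow_mult: "x > 0 \<Longrightarrow> y > 0 \<Longrightarrow> cpow (x * y) z = cpow x z * cpow y z"
  unfolding cpow_def by (simp add: powr_times_real)

lemma cpow_add: "x > 0 \<Longrightarrow> cpow x (y + z) = cpow x y * cpow x z"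
  unfolding cpow_def by (simp add: powr_add)

lemma cpow_divide: "x > 0 \<Longrightarrow> y > 0 \<Longrightarrow> cpow (x / y) z = cpow x z / cpow y z"
  using cpow_mult[of "x/y" y z] by (simp add: cpow_def field_simps)

lemma cpow_minus: "cpow x (- z) = inverse (cpow x z)"
  unfolding cpow_def by (simp add: powr_minus)

lemma cpow_nonzero: "x > 0 \<Longrightarrow> cpow x z \<noteq> 0"
  unfolding cpow_def by simp

lemma norm_cpow: "x > 0 \<Longrightarrow> complex_of_real (norm (cpow x z)) = cpow x (of_real (Re z))"
  unfolding cpow_def by (simp add: norm_powr_real_powr powr_of_real)

lemma cpow_1: "cpow 1 z = 1"
  unfolding cpow_def by simp

lemma norm_pos_powr: "complex_of_real (norm (pos_powr x z)) = pos_powr x (of_real (Re z))"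
  by (simp add: pos_powr_def norm_cpow)

lemma norm_det_powr_on:
  assumes "\<And>i j. X i j = X j i"
  shows "complex_of_real (norm (det_powr_on S X z)) = det_powr_on S X (of_real (Re z))"
  using norm_cpow[OF det_on_pos[of X S, OF assms]] by (simp add: det_powr_on_def)

lemma det_powr_on_empty: "det_powr_on {} X z = 1"
  by (simp add: det_powr_on_def posdef_on_def det_on_empty cpow_1)

lemma det_powr_on_cong:
  fixes X :: "'n::finite \<Rightarrow> 'n \<Rightarrow> real"
  assumes "\<And>i j. i \<in> S \<Longrightarrow> j \<in> S \<Longrightarrow> X i j = Y i j"
  shows "det_powr_on S X z = det_powr_on S Y z"
  using det_on_cong[of S X Y, OF assms] posdef_on_cong[of S X Y, OF assms] by (simp add: det_powr_on_def)

text \<open>Both factors are positive on the cone, so the complex power is multiplicative without a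
  branch correction; off the cone both sides are 0.\<close>

lemma det_powr_on_insert:
  assumes t: "t \<notin> S" and sym: "\<And>i j. X i j = X j i"
  shows "det_powr_on (insert t S) X z = pos_powr (X t t) z * det_powr_on S (schur t X) z"
proof (cases "posdef_on (insert t S) X")
  case True
  then have *: "X t t > 0" "posdef_on S (schur t X)"
    using posdef_on_insert[of S t X] assms by auto
  have "det_on S (schur t X) > 0"
    by (intro det_on_pos schur_sym assms *)
  then show ?thesis
    using * True by (simp add: det_powr_on_def pos_powr_def det_on_insert[OF t sym] cpow_mult)
next
  case False
  then show ?thesis
    using posdef_on_insert[of S t X] assms by (auto simp: det_powr_on_def pos_powr_def)
qed

lemma pos_powr_measurable [measurable]:
  assumes [measurable]: "f \<in> borel_measurable M"
  shows "(\<lambda>x. pos_powr (f x) z) \<in> borel_measurable M"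
proof -
  \<comment> \<open>For a positive base the complex logarithm is the real one, whose measurability
    is immediate.\<close>
  have "pos_powr y z = (if y > 0 then exp (z * complex_of_real (ln y)) else 0)" for y
    by (auto simp: pos_powr_def cpow_def powr_def Ln_of_real)
  then show ?thesis by simp
qed

text \<open>The pivot recursion expresses the power, cone condition included, through scalar
  \<open>pos_powr\<close>, so the positive cone itself is never shown measurable separately. Entries
  are restricted to \<open>S\<close> because the product spaces below carry no other
  coordinates.\<close>

lemma det_powr_on_measurable:
  fixes X :: "'a \<Rightarrow> 'n::finite \<Rightarrow> 'n \<Rightarrow> real"
  assumes "\<And>i j. i \<in> S \<Longrightarrow> j \<in> S \<Longrightarrow> (\<lambda>x. X x i j) \<in> borel_measurable M"
    and "\<And>x i j. X x i j = X x j i"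
  shows "(\<lambda>x. det_powr_on S (X x) z) \<in> borel_measurable M"
  using finite[of S] assms
proof (induction S arbitrary: X rule: finite_induct)
  case empty
  then show ?case by (simp add: det_powr_on_empty)
next
  case (insert t S)
  have [measurable]: "(\<lambda>x. X x i j) \<in> borel_measurable M" if "i \<in> insert t S" "j \<in> insert t S" for i j
    using insert.prems that by auto
  have [measurable]: "(\<lambda>x. det_powr_on S (schur t (X x)) z) \<in> borel_measurable M"
  proof (rule insert.IH)
    show "(\<lambda>x. schur t (X x) i j) \<in> borel_measurable M" if "i \<in> S" "j \<in> S" for i j
    proof -
      have [measurable]: "(\<lambda>x. X x i j) \<in> borel_measurable M" "(\<lambda>x. X x i t) \<in> borel_measurable M"
        "(\<lambda>x. X x t j) \<in> borel_measurable M" "(\<lambda>x. X x t t) \<in> borel_measurable M"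
        using insert.prems(1) that by auto
      show ?thesis unfolding schur_def by measurable
    qed
    show "schur t (X x) i j = schur t (X x) j i" for x i j
      by (intro schur_sym insert.prems)
  qed
  have "(\<lambda>x. pos_powr (X x t t) z * det_powr_on S (schur t (X x)) z) \<in> borel_measurable M"
    by measurable
  then show ?case
    using insert by (simp add: det_powr_on_insert)
qed

section \<open>Euler integrals with complex exponents\<close>

text \<open>The norm is integrated as a complex function so that one formula with complex exponents
  supplies both the premise on values and the premise on absolute values.\<close>

lemma has_bochner_integral_pair:
  fixes f :: "'a \<times> 'b \<Rightarrow> complex"
  assumes "pair_sigma_finite M1 M2"
    and f: "f \<in> borel_measurable (M1 \<Otimes>\<^sub>M M2)"
    and g: "\<And>x. x \<in> space M1 \<Longrightarrow> has_bochner_integral M2 (\<lambda>y. f (x, y)) (g x)"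
    and h: "\<And>x. x \<in> space M1 \<Longrightarrow> has_bochner_integral M2 (\<lambda>y. complex_of_real (norm (f (x, y)))) (h x)"
    and int: "integrable M1 h"
    and v: "has_bochner_integral M1 g v"
  shows "has_bochner_integral (M1 \<Otimes>\<^sub>M M2) f v"
proof -
  interpret pair_sigma_finite M1 M2 by fact
  have "(\<integral>y. norm (f (x, y)) \<partial>M2) = Re (h x)" if "x \<in> space M1" for x
    using h[OF that] by (simp add: has_bochner_integral_iff) (metis Re_complex_of_real)
  then have "integrable M1 (\<lambda>x. \<integral>y. norm (f (x, y)) \<partial>M2) = integrable M1 (\<lambda>x. Re (h x))"
    by (intro Bochner_Integration.integrable_cong refl) auto
  then have "integrable (M1 \<Otimes>\<^sub>M M2) f"
    using int g by (intro Fubini_integrable f) (auto simp: has_bochner_integral_iff)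
  moreover have "(\<integral>x. \<integral>y. f (x, y) \<partial>M2 \<partial>M1) = (\<integral>x. g x \<partial>M1)"
    using g by (intro Bochner_Integration.integral_cong refl) (auto simp: has_bochner_integral_iff)
  ultimately show ?thesis
    using v integral_fst'[of f] by (auto simp: has_bochner_integral_iff)
qed

lemma cpow_unit: "cpow x 1 = of_real x"
  by (simp add: cpow_def)

lemma pos_powr_scale: "z > 0 \<Longrightarrow> pos_powr (z * c) y = cpow z y * pos_powr c y"
  by (auto simp: pos_powr_def cpow_mult zero_less_mult_iff)

lemma Re_pos_not_nonpos_Int: "Re z > 0 \<Longrightarrow> z \<notin> \<int>\<^sub>\<le>\<^sub>0"
  by (auto elim!: nonpos_Ints_cases)

lemma has_bochner_integral_Gamma:
  assumes "Re a > 0"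
  shows "has_bochner_integral lborel (\<lambda>t. pos_powr t (a - 1) * of_real (exp (- t))) (Gamma a)"
proof -
  let ?f = "\<lambda>t. complex_of_real t powr (a - 1) / complex_of_real (exp t)"
  have eq: "indicator {0<..} t *\<^sub>R ?f t = pos_powr t (a - 1) * of_real (exp (- t))" for t
    by (simp add: pos_powr_def cpow_def exp_minus field_simps)
  have si: "set_integrable lebesgue {0<..} ?f"
    using absolutely_integrable_Gamma_integral'[OF assms] .
  have "set_lebesgue_integral lebesgue {0<..} ?f = Gamma a"
    using set_lebesgue_integral_eq_integral(2)[OF si] Gamma_integral_complex'[OF assms]
    by (simp add: integral_unique)
  then have "has_bochner_integral lebesgue (\<lambda>t. pos_powr t (a - 1) * of_real (exp (- t))) (Gamma a)"
    using si unfolding set_integrable_def set_lebesgue_integral_def eq has_bochner_integral_iff by simp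
  \<comment> \<open>Borel measurability lets the result descend from the completed measure to
    \<open>lborel\<close>.\<close>
  moreover have "(\<lambda>t. pos_powr t (a - 1) * of_real (exp (- t))) \<in> borel_measurable lborel"
    by measurable
  ultimately show ?thesis
    by (simp add: has_bochner_integral_iff integrable_completion integral_completion)
qed

lemma has_bochner_integral_shift:
  fixes f :: "real \<Rightarrow> complex"
  assumes "has_bochner_integral lborel f v"
  shows "has_bochner_integral lborel (\<lambda>x. f (x + t)) v"
  using assms lborel_has_bochner_integral_real_affine_iff[of 1 f v t] by (simp add: add.commute)

text \<open>Euler's argument: x^(a-1) (z-x)^(b-1) exp(-z) is integrated over the plane in both
  orders. Taking z first gives \<open>Gamma a * Gamma b\<close>; taking x first gives, by
  homogeneity, \<open>Gamma (a + b)\<close> times the integral for d = 1.\<close>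

lemma has_bochner_integral_pos_powr_convolution:
  assumes a: "Re a > 0" and b: "Re b > 0"
  shows "has_bochner_integral lborel (\<lambda>c. pos_powr c (a - 1) * pos_powr (d - c) (b - 1))
    (pos_powr d (a + b - 1) * Beta a b)"
proof -
  define F where "F = (\<lambda>a b x z. pos_powr x (a - 1) * pos_powr (z - x) (b - 1) * complex_of_real (exp (- z)))"
  have sec: "has_bochner_integral lborel (F a b x) (pos_powr x (a - 1) * of_real (exp (- x)) * Gamma b)"
    if "Re b > 0" for a b x
  proof -
    have "has_bochner_integral lborel (\<lambda>z. pos_powr x (a - 1) * of_real (exp (- x)) *
        (pos_powr (z + - x) (b - 1) * of_real (exp (- (z + - x))))) (pos_powr x (a - 1) * of_real (exp (- x)) * Gamma b)"
      by (intro has_bochner_integral_mult_right has_bochner_integral_shift[OF has_bochner_integral_Gamma] that)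
    moreover have "exp (- x) * exp (- (z + - x)) = exp (- z)" for z :: real
      by (simp add: exp_add[symmetric])
    then have "complex_of_real (exp (- x)) * of_real (exp (- (z + - x))) = of_real (exp (- z))" for z :: real
      by (metis of_real_mult)
    then have "pos_powr x (a - 1) * of_real (exp (- x)) * (pos_powr (z + - x) (b - 1) * of_real (exp (- (z + - x)))) = F a b x z" for z
      unfolding F_def by (simp add: mult_ac)
    ultimately show ?thesis by simp
  qed
  have psf: "pair_sigma_finite lborel (lborel :: real measure)" ..
  have Fmeas: "case_prod (F a b) \<in> borel_measurable (lborel \<Otimes>\<^sub>M lborel)" for a b
    unfolding F_def by measurable
  have nF: "complex_of_real (norm (F a b x z)) = F (of_real (Re a)) (of_real (Re b)) x z" for x z
    unfolding F_def norm_mult of_real_mult norm_pos_powr by simp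
  have "has_bochner_integral (lborel \<Otimes>\<^sub>M lborel) (case_prod (F a b)) (Gamma a * Gamma b)"
  proof (rule has_bochner_integral_pair[OF psf Fmeas])
    show "has_bochner_integral lborel (\<lambda>y. case_prod (F a b) (x, y)) (pos_powr x (a - 1) * of_real (exp (- x)) * Gamma b)" for x
      using sec[OF b] by simp
    show "has_bochner_integral lborel (\<lambda>y. complex_of_real (norm (case_prod (F a b) (x, y))))
       (pos_powr x (of_real (Re a) - 1) * of_real (exp (- x)) * Gamma (of_real (Re b)))" for x
      using sec[of "of_real (Re b)"] b by (simp add: nF)
    show "integrable lborel (\<lambda>x. pos_powr x (of_real (Re a) - 1) * of_real (exp (- x)) * Gamma (of_real (Re b)))"
      using has_bochner_integral_Gamma[of "of_real (Re a)"] a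
      by (intro integrable_mult_left) (simp add: has_bochner_integral_iff)
    show "has_bochner_integral lborel (\<lambda>x. pos_powr x (a - 1) * of_real (exp (- x)) * Gamma b) (Gamma a * Gamma b)"
      by (intro has_bochner_integral_mult_left has_bochner_integral_Gamma a)
  qed
  then have int: "integrable (lborel \<Otimes>\<^sub>M lborel) (case_prod (F a b))"
    and val: "integral\<^sup>L (lborel \<Otimes>\<^sub>M lborel) (case_prod (F a b)) = Gamma a * Gamma b"
    by (auto simp: has_bochner_integral_iff)
  define G where "G = (\<lambda>d c. pos_powr c (a - 1) * pos_powr (d - c) (b - 1))"
  \<comment> \<open>The integrand is homogeneous of degree a + b - 2; the Jacobian d raises this to
    a + b - 1.\<close>
  have scale: "G d (d * c) = cpow d (a + b - 2) * G 1 c" if "d > 0" for d c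
  proof -
    have "G d (d * c) = pos_powr (d * c) (a - 1) * pos_powr (d * (1 - c)) (b - 1)"
      by (simp add: G_def algebra_simps)
    also have "\<dots> = cpow d ((a - 1) + (b - 1)) * G 1 c"
      using that by (simp only: pos_powr_scale cpow_add G_def) (simp add: mult_ac)
    finally show ?thesis by (simp add: algebra_simps)
  qed
  have pw2: "cpow d (a + b - 2) * of_real d = cpow d (a + b - 1)" if "d > 0" for d
    using cpow_add[OF that, of "a + b - 2" 1] by (simp add: cpow_unit algebra_simps)
  have G0: "G d c = 0" if "d \<le> 0" for d c
    using that by (auto simp: G_def pos_powr_def)
  have intG: "integrable lborel (G d) \<longleftrightarrow> integrable lborel (G 1)" if "d > 0" for d
  proof -
    have "integrable lborel (G d) \<longleftrightarrow> integrable lborel (\<lambda>c. G d (0 + d * c))"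
      by (rule lborel_integrable_real_affine_iff[symmetric]) (use that in auto)
    also have "\<dots> \<longleftrightarrow> integrable lborel (G 1)"
      using integrable_mult_right[of "cpow d (a + b - 2)" lborel "G 1"]
        integrable_mult_right[of "inverse (cpow d (a + b - 2))" lborel "\<lambda>c. cpow d (a + b - 2) * G 1 c"]
      by (auto simp: scale[OF that] cpow_nonzero[OF that] mult.assoc[symmetric])
    finally show ?thesis .
  qed
  have valG: "integral\<^sup>L lborel (G d) = pos_powr d (a + b - 1) * integral\<^sup>L lborel (G 1)" for d
  proof (cases "d > 0")
    case True
    have "integral\<^sup>L lborel (G d) = \<bar>d\<bar> *\<^sub>R (\<integral>c. G d (0 + d * c) \<partial>lborel)"
      by (rule lborel_integral_real_affine) (use True in auto)
    also have "\<dots> = cpow d (a + b - 2) * of_real d * integral\<^sup>L lborel (G 1)"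
      using True by (simp add: scale scaleR_conv_of_real)
    finally show ?thesis using True by (simp add: pw2 pos_powr_def)
  next
    case False
    then have "G d = (\<lambda>_. 0)" using G0[of d] by auto
    with False show ?thesis by (simp add: pos_powr_def)
  qed
  \<comment> \<open>Fubini makes the section at almost every z integrable. By scaling, a failure at
    1 would be a failure at every positive z, but the interval (0,1) is not a null set.\<close>
  have G1: "integrable lborel (G 1)"
  proof (rule ccontr)
    assume non: "\<not> integrable lborel (G 1)"
    have "AE z in lborel. integrable lborel (\<lambda>x. F a b x z)"
      by (rule lborel_pair.AE_integrable_snd[OF int])
    then have "AE z in lborel. z \<notin> {0<..<1::real}"
    proof (rule AE_mp, intro AE_I2 impI)
      fix z :: real assume "integrable lborel (\<lambda>x. F a b x z)"
      then have "integrable lborel (\<lambda>x. of_real (exp z) * F a b x z)" by (intro integrable_mult_right)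
      also have "(\<lambda>x. of_real (exp z) * F a b x z) = G z"
        by (simp add: F_def G_def exp_minus fun_eq_iff field_simps)
      finally show "z \<notin> {0<..<1}" using intG[of z] non by auto
    qed
    then have "{0<..<1::real} \<in> null_sets lborel"
      by (subst AE_iff_null_sets) auto
    then show False by (simp add: null_sets_def)
  qed
  have "Gamma a * Gamma b = (\<integral>z. (\<integral>x. F a b x z \<partial>lborel) \<partial>lborel)"
    using lborel_pair.integral_snd[OF int] val by simp
  also have "\<dots> = (\<integral>z. (pos_powr z (a + b - 1) * of_real (exp (- z))) * integral\<^sup>L lborel (G 1) \<partial>lborel)"
  proof (intro Bochner_Integration.integral_cong refl)
    fix z :: real
    have "(\<integral>x. F a b x z \<partial>lborel) = (\<integral>x. G z x * of_real (exp (- z)) \<partial>lborel)"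
      by (simp add: F_def G_def)
    also have "\<dots> = integral\<^sup>L lborel (G z) * of_real (exp (- z))"
      by simp
    finally show "(\<integral>x. F a b x z \<partial>lborel) = (pos_powr z (a + b - 1) * of_real (exp (- z))) * integral\<^sup>L lborel (G 1)"
      by (simp add: valG[of z])
  qed
  also have "\<dots> = Gamma (a + b) * integral\<^sup>L lborel (G 1)"
    using has_bochner_integral_Gamma[of "a + b"] a b by (simp add: has_bochner_integral_iff)
  finally have "integral\<^sup>L lborel (G 1) = Beta a b"
    using Re_pos_not_nonpos_Int[of "a + b"] a b by (simp add: Beta_def Gamma_eq_zero_iff field_simps)
  moreover have "integrable lborel (G d)"
    using intG[of d] G1 G0[of d] by (cases "d > 0") (auto cong: Bochner_Integration.integrable_cong)
  ultimately show ?thesis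
    using valG[of d] by (simp add: has_bochner_integral_iff G_def)
qed


text \<open>Legendre duplication at q + 1. The symmetric Beta value arises when a quadratic is split
  into two linear factors; the form with entry 1/2 is the one whose products telescope.\<close>

lemma cpow_2_Beta_duplication:
  assumes "Re q > -1"
  shows "cpow 2 (2 * q + 1) * Beta (q + 1) (q + 1) = Beta (1/2) (q + 1)"
proof -
  have n: "q + 1 \<notin> \<int>\<^sub>\<le>\<^sub>0" "q + 1 + 1/2 \<notin> \<int>\<^sub>\<le>\<^sub>0" "2 * (q + 1) \<notin> \<int>\<^sub>\<le>\<^sub>0"
    using assms by (auto intro!: Re_pos_not_nonpos_Int)
  let ?e = "exp ((1 - 2 * (q + 1)) * complex_of_real (ln 2))"
  have e: "cpow 2 (2 * q + 1) * ?e = 1"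
    unfolding cpow_def powr_def by (simp add: exp_add[symmetric] algebra_simps flip: Ln_of_real)
  have d: "Gamma (q + 1) * Gamma (q + 1 + 1/2) = ?e * of_real (sqrt pi) * Gamma (2 * (q + 1))"
    by (rule Gamma_legendre_duplication[OF n(1,2)])
  have g: "Gamma (q + 1 + 1/2) \<noteq> 0" "Gamma (2 * (q + 1)) \<noteq> 0"
    using n by (simp_all add: Gamma_eq_zero_iff)
  have "cpow 2 (2 * q + 1) * Gamma (q + 1) * (Gamma (q + 1) * Gamma (q + 1 + 1/2))
      = (cpow 2 (2 * q + 1) * ?e) * of_real (sqrt pi) * Gamma (q + 1) * Gamma (2 * (q + 1))"
    unfolding d by (simp add: mult_ac)
  then have "cpow 2 (2 * q + 1) * (Gamma (q + 1) * Gamma (q + 1)) / Gamma (2 * (q + 1))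
      = of_real (sqrt pi) * Gamma (q + 1) / Gamma (q + 1 + 1/2)"
    unfolding e using g by (simp add: field_simps)
  moreover have "2 * (q + 1) = (q + 1) + (q + 1)" "q + 1 + 1/2 = 1/2 + (q + 1)" by simp_all
  ultimately show ?thesis
    unfolding Beta_def Gamma_one_half_complex by (simp only: times_divide_eq_right)
qed

text \<open>With r the square root of w/k, w - k x^2 = k (r + x)(r - x), so a shift by r gives the
  scalar beta integral over (0, 2r) with equal exponents. For w \<le> 0 both sides vanish.\<close>

lemma has_bochner_integral_pos_powr_quadratic:
  assumes k: "k > 0" and q: "Re q > -1"
  shows "has_bochner_integral lborel (\<lambda>x. pos_powr (w - k * x\<^sup>2) q)
    (pos_powr w (q + 1/2) * cpow k (- 1/2) * Beta (1/2) (q + 1))"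
proof (cases "w > 0")
  case False
  have "0 \<le> k * x\<^sup>2" for x using k by simp
  then have "w - k * x\<^sup>2 \<le> 0" for x using False by (smt (verit))
  then have "pos_powr (w - k * x\<^sup>2) q = 0" for x
    unfolding pos_powr_def by (auto simp: not_less[symmetric])
  then show ?thesis using False by (simp add: has_bochner_integral_zero) (simp add: pos_powr_def has_bochner_integral_zero)
next
  case True
  define r where "r = sqrt (w / k)"
  have r: "r > 0" "r * r = w / k" using True k by (simp_all add: r_def)
  have "has_bochner_integral lborel (\<lambda>c. pos_powr c ((q + 1) - 1) * pos_powr (2 * r - c) ((q + 1) - 1))
      (pos_powr (2 * r) ((q + 1) + (q + 1) - 1) * Beta (q + 1) (q + 1))"
    by (rule has_bochner_integral_pos_powr_convolution) (use q in auto)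
  from has_bochner_integral_shift[OF this, of r]
  have "has_bochner_integral lborel (\<lambda>x. cpow k q * (pos_powr (x + r) q * pos_powr (2 * r - (x + r)) q))
      (cpow k q * (pos_powr (2 * r) ((q + 1) + (q + 1) - 1) * Beta (q + 1) (q + 1)))"
    by (intro has_bochner_integral_mult_right) simp
  moreover have "cpow k q * (pos_powr (x + r) q * pos_powr (2 * r - (x + r)) q) = pos_powr (w - k * x\<^sup>2) q" for x
  proof -
    have f: "w - k * x\<^sup>2 = k * ((x + r) * (r - x))"
      using r k by (simp add: algebra_simps power2_eq_square)
    show ?thesis
    proof (cases "x + r > 0 \<and> r - x > 0")
      case True
      then show ?thesis unfolding f using k by (simp add: pos_powr_def cpow_mult)
    next
      case False
      \<comment> \<open>The two factors cannot both be negative: their sum is 2 r > 0.\<close>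
      then have "\<not> w - k * x\<^sup>2 > 0"
        unfolding f using k r by (auto simp: zero_less_mult_iff)
      then show ?thesis using False by (auto simp: pos_powr_def)
    qed
  qed
  moreover have "cpow k q * (pos_powr (2 * r) ((q + 1) + (q + 1) - 1) * Beta (q + 1) (q + 1))
     = pos_powr w (q + 1/2) * cpow k (- 1/2) * Beta (1/2) (q + 1)"
  proof -
    \<comment> \<open>Splitting the exponent into equal halves trades r for r * r = w/k by
      multiplicativity in the base alone, with no power-of-a-power law.\<close>
    have "cpow r ((q + 1/2) + (q + 1/2)) = cpow (r * r) (q + 1/2)"
      by (simp only: cpow_add[OF r(1)] cpow_mult[OF r(1) r(1)])
    also have "\<dots> = cpow w (q + 1/2) * cpow k (- (q + 1/2))"
      unfolding r(2) by (simp only: cpow_divide[OF True k] cpow_minus divide_inverse[of "cpow w (q + 1/2)"])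
    finally have 1: "cpow r (2 * q + 1) = cpow w (q + 1/2) * cpow k (- (q + 1/2))" by simp
    have 2: "cpow k q * cpow k (- (q + 1/2)) = cpow k (- 1/2)"
      using k by (simp add: cpow_add[symmetric])
    have "cpow k q * (pos_powr (2 * r) ((q + 1) + (q + 1) - 1) * Beta (q + 1) (q + 1))
      = cpow k q * (cpow 2 (2 * q + 1) * cpow r (2 * q + 1) * Beta (q + 1) (q + 1))"
      using r by (simp add: pos_powr_def cpow_mult add.commute)
    also have "\<dots> = (cpow k q * cpow k (- (q + 1/2))) * cpow w (q + 1/2) *
         (cpow 2 (2 * q + 1) * Beta (q + 1) (q + 1))"
      unfolding 1 by (simp add: mult_ac)
    finally show ?thesis
      unfolding 2 cpow_2_Beta_duplication[OF q] using True by (simp add: pos_powr_def)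
  qed
  ultimately show ?thesis by simp
qed

section \<open>Iterated integration over coordinates\<close>

lemma product_sigma_finite_lborel: "product_sigma_finite (\<lambda>_. lborel :: real measure)"
  by standard

lemma sigma_finite_PiM_lborel: "finite I \<Longrightarrow> sigma_finite_measure (PiM I (\<lambda>_. lborel :: real measure))"
  by (rule product_sigma_finite.sigma_finite[OF product_sigma_finite_lborel])

lemma has_bochner_integral_PiM_Un:
  fixes f :: "('i \<Rightarrow> real) \<Rightarrow> complex"
  assumes fin: "finite I" "finite J" and disj: "I \<inter> J = {}"
    and f: "f \<in> borel_measurable (PiM (I \<union> J) (\<lambda>_. lborel))"
    and "\<And>x. x \<in> space (PiM I (\<lambda>_. lborel)) \<Longrightarrow>
       has_bochner_integral (PiM J (\<lambda>_. lborel)) (\<lambda>y. f (merge I J (x, y))) (g x)"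
    and "\<And>x. x \<in> space (PiM I (\<lambda>_. lborel)) \<Longrightarrow>
       has_bochner_integral (PiM J (\<lambda>_. lborel)) (\<lambda>y. complex_of_real (norm (f (merge I J (x, y))))) (h x)"
    and "integrable (PiM I (\<lambda>_. lborel)) h"
    and "has_bochner_integral (PiM I (\<lambda>_. lborel)) g v"
  shows "has_bochner_integral (PiM (I \<union> J) (\<lambda>_. lborel)) f v"
proof -
  interpret product_sigma_finite "\<lambda>_. lborel :: real measure"
    by (rule product_sigma_finite_lborel)
  have "pair_sigma_finite (PiM I (\<lambda>_. lborel :: real measure)) (PiM J (\<lambda>_. lborel :: real measure))"
    using fin by (intro pair_sigma_finite.intro sigma_finite)
  then have "has_bochner_integral (PiM I (\<lambda>_. lborel) \<Otimes>\<^sub>M PiM J (\<lambda>_. lborel)) (\<lambda>p. f (merge I J p)) v"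
    by (rule has_bochner_integral_pair[where g = g and h = h])
       (use assms in \<open>auto intro: measurable_compose[OF measurable_merge]\<close>)
  then have "has_bochner_integral (distr (PiM I (\<lambda>_. lborel) \<Otimes>\<^sub>M PiM J (\<lambda>_. lborel)) (PiM (I \<union> J) (\<lambda>_. lborel)) (merge I J)) f v"
    using f by (simp add: has_bochner_integral_iff integrable_distr_eq integral_distr)
  then show ?thesis by (simp add: distr_merge[OF disj fin])
qed

lemma has_bochner_integral_PiM_insert:
  fixes f :: "('i \<Rightarrow> real) \<Rightarrow> complex"
  assumes fin: "finite I" and i: "i \<notin> I"
    and f: "f \<in> borel_measurable (PiM (insert i I) (\<lambda>_. lborel))"
    and g: "\<And>c. has_bochner_integral (PiM I (\<lambda>_. lborel)) (\<lambda>y. f (y(i := c))) (g c)"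
    and h: "\<And>c. has_bochner_integral (PiM I (\<lambda>_. lborel)) (\<lambda>y. complex_of_real (norm (f (y(i := c))))) (h c)"
    and int: "integrable lborel h"
    and v: "has_bochner_integral lborel g v"
  shows "has_bochner_integral (PiM (insert i I) (\<lambda>_. lborel)) f v"
proof -
  interpret product_sigma_finite "\<lambda>_. lborel :: real measure"
    by (rule product_sigma_finite_lborel)
  \<comment> \<open>Points of the product space are \<open>undefined\<close> off \<open>I\<close>,
    which is also the value of \<open>merge\<close> off its index sets; so merging one coordinate is
    a function update.\<close>
  have m: "merge {i} I (x, y) = y(i := x i)" if "y \<in> space (PiM I (\<lambda>_. lborel :: real measure))" for x y
    using that i by (auto simp: merge_def space_PiM PiE_def extensional_def fun_eq_iff)
  have s: "has_bochner_integral (PiM {i} (\<lambda>_. lborel)) (\<lambda>x. k (x i)) w"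
    if "has_bochner_integral lborel k w" for k :: "real \<Rightarrow> complex" and w
  proof -
    have k: "k \<in> borel_measurable lborel"
      using that by (auto simp: has_bochner_integral_iff)
    have "has_bochner_integral (distr (PiM {i} (\<lambda>_. lborel)) lborel (\<lambda>x. x i)) k w"
      using that by (simp add: distr_singleton)
    then show ?thesis
      using k by (simp add: has_bochner_integral_iff integrable_distr_eq integral_distr)
  qed
  have "has_bochner_integral (PiM ({i} \<union> I) (\<lambda>_. lborel)) f v"
  proof (rule has_bochner_integral_PiM_Un)
    show "has_bochner_integral (PiM I (\<lambda>_. lborel)) (\<lambda>y. f (merge {i} I (x, y))) (g (x i))" for x
      using g[of "x i"] by (simp add: m cong: has_bochner_integral_cong)
    show "has_bochner_integral (PiM I (\<lambda>_. lborel)) (\<lambda>y. complex_of_real (norm (f (merge {i} I (x, y))))) (h (x i))" for x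
      using h[of "x i"] by (simp add: m cong: has_bochner_integral_cong)
    show "integrable (PiM {i} (\<lambda>_. lborel)) (\<lambda>x. h (x i))"
      using s[of h] int by (auto simp: has_bochner_integral_iff)
    show "has_bochner_integral (PiM {i} (\<lambda>_. lborel)) (\<lambda>x. g (x i)) v"
      by (rule s[OF v])
  qed (use fin i f in auto)
  then show ?thesis by simp
qed

text \<open>Translation carries boxes to boxes of equal measure, and boxes determine the product
  measure. The restriction to \<open>I\<close> keeps the translated point in the product
  space.\<close>

lemma has_bochner_integral_PiM_translate:
  fixes f :: "('i \<Rightarrow> real) \<Rightarrow> complex"
  assumes fin: "finite I"
    and f: "has_bochner_integral (PiM I (\<lambda>_. lborel)) f v"
  shows "has_bochner_integral (PiM I (\<lambda>_. lborel)) (\<lambda>x. f (\<lambda>i\<in>I. x i + a i)) v"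
proof -
  interpret product_sigma_finite "\<lambda>_. lborel :: real measure"
    by (rule product_sigma_finite_lborel)
  let ?M = "PiM I (\<lambda>_. lborel :: real measure)"
  let ?T = "\<lambda>x. \<lambda>i\<in>I. x i + a i"
  have T [measurable]: "?T \<in> measurable ?M ?M"
    by (intro measurable_restrict) measurable
  have "distr ?M ?M ?T = ?M"
  proof (rule PiM_eqI[OF fin])
    fix A :: "'i \<Rightarrow> real set"
    assume A: "\<And>i. i \<in> I \<Longrightarrow> A i \<in> sets lborel"
    have A': "(\<lambda>x. x + a i) -` A i \<in> sets lborel" if "i \<in> I" for i
    proof -
      have "(\<lambda>x. x + a i) \<in> measurable lborel borel" by measurable
      from measurable_sets[OF this, of "A i"] show ?thesis using A[OF that] by simp
    qed
    have "emeasure (distr ?M ?M ?T) (Pi\<^sub>E I A) = emeasure ?M (?T -` Pi\<^sub>E I A \<inter> space ?M)"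
      using A fin by (intro emeasure_distr T sets_PiM_I_finite) auto
    also have "?T -` Pi\<^sub>E I A \<inter> space ?M = (\<Pi>\<^sub>E i\<in>I. (\<lambda>x. x + a i) -` A i)"
      by (auto simp: space_PiM PiE_iff)
    also have "emeasure ?M \<dots> = (\<Prod>i\<in>I. emeasure lborel ((\<lambda>x. x + a i) -` A i))"
      by (intro emeasure_PiM fin A')
    also have "\<dots> = (\<Prod>i\<in>I. emeasure lborel (A i))"
    proof (intro prod.cong refl)
      fix i assume i: "i \<in> I"
      have "emeasure lborel (A i) = emeasure (distr lborel borel (\<lambda>x. a i + x)) (A i)"
        by (simp add: lborel_distr_plus)
      also have "\<dots> = emeasure lborel ((\<lambda>x. x + a i) -` A i)"
        using A[OF i] by (subst emeasure_distr) (auto simp: add.commute[of _ "a i"])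
      finally show "emeasure lborel ((\<lambda>x. x + a i) -` A i) = emeasure lborel (A i)" ..
    qed
    finally show "emeasure (distr ?M ?M ?T) (Pi\<^sub>E I A) = (\<Prod>i\<in>I. emeasure lborel (A i))" .
  qed simp
  then have "has_bochner_integral (distr ?M ?M ?T) f v" using f by simp
  then show ?thesis
    using borel_measurable_has_bochner_integral[OF f]
    by (simp add: has_bochner_integral_iff integrable_distr_eq integral_distr)
qed

section \<open>The rank-one integral\<close>

lemma has_bochner_integral_PiM_empty:
  "has_bochner_integral (PiM {} (\<lambda>_. lborel :: real measure)) (\<lambda>_. c :: complex) c"
  by (simp add: PiM_empty has_bochner_integral_iff integrable_count_space lebesgue_integral_count_space_finite)

text \<open>Translation for coordinates named by \<open>g\<close>: the shift, indexed by
  \<open>S\<close>, is carried to the coordinates by \<open>inv_into\<close>, and \<open>F\<close>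
  ignores values off \<open>S\<close>.\<close>

lemma has_bochner_integral_PiM_image_translate:
  fixes F :: "('n \<Rightarrow> real) \<Rightarrow> complex"
  assumes fin: "finite S" and inj: "inj_on g S"
    and F: "\<And>u u'. (\<And>i. i \<in> S \<Longrightarrow> u i = u' i) \<Longrightarrow> F u = F u'"
    and v: "has_bochner_integral (PiM (g ` S) (\<lambda>_. lborel)) (\<lambda>y. F (\<lambda>i. y (g i))) v"
  shows "has_bochner_integral (PiM (g ` S) (\<lambda>_. lborel)) (\<lambda>y. F (\<lambda>i. y (g i) - a i)) v"
proof -
  let ?a = "\<lambda>k. - a (inv_into S g k)"
  have "has_bochner_integral (PiM (g ` S) (\<lambda>_. lborel)) (\<lambda>y. F (\<lambda>i. (\<lambda>k\<in>g ` S. y k + ?a k) (g i))) v"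
    by (rule has_bochner_integral_PiM_translate[OF _ v]) (use fin in simp)
  moreover have "F (\<lambda>i. (\<lambda>k\<in>g ` S. y k + ?a k) (g i)) = F (\<lambda>i. y (g i) - a i)" for y
    by (rule F) (simp add: inv_into_f_f[OF inj])
  ultimately show ?thesis by simp
qed

lemma mult_mid_cong:
  fixes x y :: "'a::comm_semiring_1"
  assumes "x * y = x' * y'"
  shows "x * (p * y * r) = x' * (p * y' * r)"
proof -
  have "x * (p * y * r) = (x * y) * (p * r)" by (simp only: mult_ac)
  also have "\<dots> = x' * (p * y' * r)" unfolding assms by (simp only: mult_ac)
  finally show ?thesis .
qed

text \<open>Pivoting reproduces an integral of the same shape on \<open>S\<close>, and its value is
  a power of the scalar pivot w - k c^2; the quadratic integral in c then contributes the last Beta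
  factor. The map \<open>g\<close> names the integration variables, later the row entries {t, i}.
  Since k > 0, both sides vanish when \<open>W\<close> is not positive definite.\<close>

lemma has_bochner_integral_det_powr_on_rank_one:
  fixes W :: "'n::finite \<Rightarrow> 'n \<Rightarrow> real" and g :: "'n \<Rightarrow> 'i"
  assumes "inj_on g S" and "\<And>i j. W i j = W j i" and "k > 0" and "S = {} \<or> Re e > -1"
  shows "has_bochner_integral (PiM (g ` S) (\<lambda>_. lborel))
    (\<lambda>y. det_powr_on S (\<lambda>i j. W i j - k * (y (g i) - a i) * (y (g j) - a j)) e)
    (det_powr_on S W (e + 1/2) * cpow k (- (of_nat (card S) / 2)) * (\<Prod>i<card S. Beta (1/2) (e + 1 + of_nat i / 2)))"
  using finite[of S] assms
proof (induction S arbitrary: W k e a rule: finite_induct)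
  case empty
  have "cpow k 0 = 1" using \<open>k > 0\<close> by (simp add: cpow_def)
  with has_bochner_integral_PiM_empty[of 1] show ?case by (simp add: det_powr_on_empty)
next
  case (insert t S)
  note sym = insert.prems(2) and k = insert.prems(3)
  from insert.prems have e: "Re e > -1" and inj: "inj_on g S" and gt: "g t \<notin> g ` S" by (auto simp: insert.hyps)
  define m where "m = card S"
  define w where "w = W t t"
  define f where "f = (\<lambda>e y. det_powr_on (insert t S) (\<lambda>i j. W i j - k * y (g i) * y (g j)) e)"
  \<comment> \<open>The part of the inner integral free of c: the denominator D of the new
    coefficient k w / D contributes D^(m/2), which joins the power of the pivot.\<close>
  define K where "K = (\<lambda>e. det_powr_on S (schur t W) (e + 1/2) * cpow (k * w) (- (of_nat m / 2)) *
      (\<Prod>i<m. Beta (1/2) (e + 1 + of_nat i / 2)))"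
  have fsym: "W i j - k * y (g i) * y (g j) = W j i - k * y (g j) * y (g i)" for i j and y :: "'i \<Rightarrow> real"
    using sym[of i j] by simp
  \<comment> \<open>The exponent is quantified afresh because the claim is used at \<open>e\<close>
    and at its real part.\<close>
  have inner: "has_bochner_integral (PiM (g ` S) (\<lambda>_. lborel)) (\<lambda>y. f e (y(g t := c)))
      (pos_powr (w - k * c\<^sup>2) (e + of_nat m / 2) * K e)" if e: "Re e > -1" for e c
  proof (cases "w - k * c\<^sup>2 > 0")
    case False
    then have "f e (y(g t := c)) = 0" for y
      unfolding f_def
      by (subst det_powr_on_insert[OF insert.hyps(2) fsym]) (simp add: pos_powr_def w_def power2_eq_square)
    then have "(\<lambda>y. f e (y(g t := c))) = (\<lambda>_. 0)" by auto
    then show ?thesis using False by (simp add: pos_powr_def has_bochner_integral_zero)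
  next
    case True
    define D where "D = w - k * c\<^sup>2"
    have D: "D > 0" using True by (simp add: D_def)
    have "0 \<le> k * c\<^sup>2" using k by simp
    then have w: "w > 0" using True by linarith
    \<comment> \<open>The Schur complement of a rank-one perturbation of W is one of
      \<open>schur t W\<close>, with coefficient k w / D and centre (c/w) W i t. This is why
      \<open>k\<close> and \<open>a\<close> vary in the induction.\<close>
    have eq: "f e (y(g t := c)) = pos_powr D e * det_powr_on S (\<lambda>i j. schur t W i j -
        (k * w / D) * (y (g i) - c / w * W i t) * (y (g j) - c / w * W j t)) e" for y
    proof -
      have "schur t (\<lambda>i j. W i j - k * (y(g t := c)) (g i) * (y(g t := c)) (g j)) i j =
        schur t W i j - (k * w / D) * (y (g i) - c / w * W i t) * (y (g j) - c / w * W j t)"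
        if "i \<in> S" "j \<in> S" for i j
      proof -
        have n: "g i \<noteq> g t" "g j \<noteq> g t" using gt that by (metis imageI)+
        have "W i j - k * p * q - (r - k * p * c) * (s - k * c * q) / D =
          (W i j - r * s / w) - (k * w / D) * (p - c / w * r) * (q - c / w * s)" for p q r s
        proof -
          have wD: "w = D + k * c * c" by (simp add: D_def power2_eq_square)
          have "D * w * (k * p * q) + w * ((r - k * p * c) * (s - k * c * q))
             = D * (r * s) + k * (w * p - c * r) * (w * q - c * s)"
            unfolding wD by (simp add: algebra_simps)
          then show ?thesis using w D by (simp add: field_simps)
        qed
        from this[of "y (g i)" "y (g j)" "W i t" "W j t"] show ?thesis
          using n sym[of t j] by (simp add: schur_def D_def w_def power2_eq_square mult.assoc)
      qed
      then have 1: "det_powr_on S (schur t (\<lambda>i j. W i j - k * (y(g t := c)) (g i) * (y(g t := c)) (g j))) e =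
        det_powr_on S (\<lambda>i j. schur t W i j - (k * w / D) * (y (g i) - c / w * W i t) * (y (g j) - c / w * W j t)) e"
        by (rule det_powr_on_cong)
      have 2: "W t t - k * (y(g t := c)) (g t) * (y(g t := c)) (g t) = D"
        by (simp add: D_def w_def power2_eq_square)
      show ?thesis
        unfolding f_def by (subst det_powr_on_insert[OF insert.hyps(2) fsym], unfold 1 2) (rule refl)
    qed
    have "has_bochner_integral (PiM (g ` S) (\<lambda>_. lborel)) (\<lambda>y. f e (y(g t := c)))
      (pos_powr D e * (det_powr_on S (schur t W) (e + 1/2) * cpow (k * w / D) (- (of_nat (card S) / 2)) *
        (\<Prod>i<card S. Beta (1/2) (e + 1 + of_nat i / 2))))"
      unfolding eq
      by (intro has_bochner_integral_mult_right insert.IH inj schur_sym sym) (use e k w D in auto)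
    moreover have "pos_powr D e * cpow (k * w / D) (- (of_nat m / 2)) = pos_powr D (e + of_nat m / 2) * cpow (k * w) (- (of_nat m / 2))"
    proof -
      have kw: "k * w > 0" using k w by simp
      have "cpow D (e + of_nat m / 2) * cpow D (- (of_nat m / 2)) = cpow D e"
        using cpow_add[OF D, of "e + of_nat m / 2" "- (of_nat m / 2)"] by simp
      then show ?thesis
        using D cpow_nonzero[OF D] unfolding cpow_divide[OF kw D] pos_powr_def by (simp add: field_simps)
    qed
    then have "pos_powr D e * (P * cpow (k * w / D) (- (of_nat m / 2)) * R) =
        pos_powr D (e + of_nat m / 2) * (P * cpow (k * w) (- (of_nat m / 2)) * R)" for P R
      by (rule mult_mid_cong)
    ultimately show ?thesis
      by (simp only: K_def m_def[symmetric] D_def[symmetric])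
  qed
  have "has_bochner_integral (PiM (insert (g t) (g ` S)) (\<lambda>_. lborel)) (f e)
     (pos_powr w (e + of_nat m / 2 + 1/2) * cpow k (- 1/2) * Beta (1/2) (e + of_nat m / 2 + 1) * K e)"
  proof (rule has_bochner_integral_PiM_insert[OF _ gt])
    show "f e \<in> borel_measurable (PiM (insert (g t) (g ` S)) (\<lambda>_. lborel))"
      unfolding f_def
    proof (rule det_powr_on_measurable)
      fix i j assume ij: "i \<in> insert t S" "j \<in> insert t S"
      have [measurable]: "(\<lambda>x. x (g i)) \<in> borel_measurable (PiM (insert (g t) (g ` S)) (\<lambda>_. lborel))"
        "(\<lambda>x. x (g j)) \<in> borel_measurable (PiM (insert (g t) (g ` S)) (\<lambda>_. lborel))"
        using ij by (auto intro!: measurable_component_singleton[where M="\<lambda>_. lborel", simplified])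
      show "(\<lambda>x. W i j - k * x (g i) * x (g j)) \<in> borel_measurable (PiM (insert (g t) (g ` S)) (\<lambda>_. lborel))"
        by measurable
    qed (rule fsym)
    show "has_bochner_integral (PiM (g ` S) (\<lambda>_. lborel)) (\<lambda>y. f e (y(g t := c)))
      (pos_powr (w - k * c\<^sup>2) (e + of_nat m / 2) * K e)" for c
      by (rule inner[OF e])
    have "complex_of_real (norm (f e y)) = f (of_real (Re e)) y" for y
      unfolding f_def by (rule norm_det_powr_on[OF fsym])
    then show "has_bochner_integral (PiM (g ` S) (\<lambda>_. lborel)) (\<lambda>y. complex_of_real (norm (f e (y(g t := c)))))
      (pos_powr (w - k * c\<^sup>2) (of_real (Re e) + of_nat m / 2) * K (of_real (Re e)))" for c
      using inner[of "of_real (Re e)" c] e by simp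
    show "integrable lborel (\<lambda>c. pos_powr (w - k * c\<^sup>2) (of_real (Re e) + of_nat m / 2) * K (of_real (Re e)))"
      using has_bochner_integral_pos_powr_quadratic[OF k, of "of_real (Re e) + of_nat m / 2" w] e
      by (intro integrable_mult_left) (simp add: has_bochner_integral_iff)
    show "has_bochner_integral lborel (\<lambda>c. pos_powr (w - k * c\<^sup>2) (e + of_nat m / 2) * K e)
      (pos_powr w (e + of_nat m / 2 + 1/2) * cpow k (- 1/2) * Beta (1/2) (e + of_nat m / 2 + 1) * K e)"
      by (intro has_bochner_integral_mult_left has_bochner_integral_pos_powr_quadratic k) (use e in simp)
  qed simp
  moreover have "pos_powr w (e + of_nat m / 2 + 1/2) * cpow k (- 1/2) * Beta (1/2) (e + of_nat m / 2 + 1) * K e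
     = det_powr_on (insert t S) W (e + 1/2) * cpow k (- (of_nat (card (insert t S)) / 2)) *
       (\<Prod>i<card (insert t S). Beta (1/2) (e + 1 + of_nat i / 2))"
  proof (cases "w > 0")
    case True
    \<comment> \<open>The surplus w^(m/2) from the quadratic integral cancels against the factor w
      in the base k w of \<open>K\<close>.\<close>
    have 1: "cpow w (e + of_nat m / 2 + 1/2) * cpow w (- (of_nat m / 2)) = cpow w (e + 1/2)"
      using True by (simp add: cpow_add[symmetric])
    have 2: "cpow k (- 1/2) * cpow k (- (of_nat m / 2)) = cpow k (- (of_nat (Suc m) / 2))"
    proof -
      have "- 1/2 + - (of_nat m / 2) = - (of_nat (Suc m) / 2 :: complex)"
        by (simp add: field_simps)
      then show ?thesis by (simp only: cpow_add[OF k, symmetric])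
    qed
    have "det_powr_on (insert t S) W (e + 1/2) = cpow w (e + 1/2) * det_powr_on S (schur t W) (e + 1/2)"
      using True by (subst det_powr_on_insert[OF insert.hyps(2) sym]) (simp add: pos_powr_def w_def)
    then have "det_powr_on (insert t S) W (e + 1/2) * cpow k (- (of_nat (Suc m) / 2)) *
        (\<Prod>i<Suc m. Beta (1/2) (e + 1 + of_nat i / 2))
      = (cpow w (e + of_nat m / 2 + 1/2) * cpow w (- (of_nat m / 2))) * det_powr_on S (schur t W) (e + 1/2) *
        (cpow k (- 1/2) * cpow k (- (of_nat m / 2))) *
        ((\<Prod>i<m. Beta (1/2) (e + 1 + of_nat i / 2)) * Beta (1/2) (e + of_nat m / 2 + 1))"
      unfolding 1 2 by (simp add: add_ac)
    from this[symmetric] show ?thesis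
      using insert.hyps True by (simp add: K_def cpow_mult[OF k True] pos_powr_def m_def[symmetric] mult_ac)
  next
    case False
    then show ?thesis
      by (subst det_powr_on_insert[OF insert.hyps(2) sym]) (simp add: pos_powr_def w_def)
  qed
  ultimately have "has_bochner_integral (PiM (g ` insert t S) (\<lambda>_. lborel))
      (\<lambda>y. det_powr_on (insert t S) (\<lambda>i j. W i j - k * y (g i) * y (g j)) e)
    (det_powr_on (insert t S) W (e + 1/2) * cpow k (- (of_nat (card (insert t S)) / 2)) *
       (\<Prod>i<card (insert t S). Beta (1/2) (e + 1 + of_nat i / 2)))"
    by (simp add: f_def)
  \<comment> \<open>So far the centre was 0; a translation of the coordinates supplies the general
    \<open>a\<close>.\<close>
  then show ?case
    by (intro has_bochner_integral_PiM_image_translate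
          [where F="\<lambda>u. det_powr_on (insert t S) (\<lambda>i j. W i j - k * u i * u j) e"] insert.prems(1))
       (auto intro!: det_powr_on_cong)
qed

section \<open>The matrix-variate beta integral\<close>

definition sym_index_on :: "'n set \<Rightarrow> 'n set set" where
  "sym_index_on S = {{i, j} | i j. i \<in> S \<and> j \<in> S}"

lemma sym_index_on_eq_image: "sym_index_on S = (\<lambda>(i, j). {i, j}) ` (S \<times> S)"
  by (auto simp: sym_index_on_def image_def)

lemma finite_sym_index_on: "finite S \<Longrightarrow> finite (sym_index_on S)"
  by (simp add: sym_index_on_eq_image)

text \<open>The three groups of integration variables of a pivoting step: the pivot, the rest of its
  row, and the remaining block.\<close>

lemma sym_index_on_insert: "sym_index_on (insert t S) = insert {t} ((\<lambda>i. {t, i}) ` S \<union> sym_index_on S)"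
  unfolding sym_index_on_eq_image by (auto simp: insert_commute image_iff)

lemma sym_index_on_UNIV: "sym_index_on UNIV = sym_index"
  by (simp add: sym_index_on_def sym_index_def)

text \<open>A symmetric function of ordered pairs descends to unordered ones. It turns the matrix u
  u^T / c into a translation vector for the coordinates {i, j}.\<close>

lemma symmetric_lift:
  fixes q :: "'a \<Rightarrow> 'a \<Rightarrow> 'b"
  assumes "\<And>i j. q i j = q j i"
  shows "\<exists>T. \<forall>i j. T {i, j} = q i j"
proof (intro exI allI)
  fix i j :: 'a
  let ?P = "\<lambda>p. {i, j} = {fst p, snd p}"
  have "?P (SOME p. ?P p)" by (rule someI[of ?P "(i, j)"]) simp
  then show "(\<lambda>k. let p = SOME p. k = {fst p, snd p} in q (fst p) (snd p)) {i, j} = q i j"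
    using assms by (auto simp: Let_def doubleton_eq_iff)
qed

definition beta_kernel :: "'n set \<Rightarrow> ('n::finite \<Rightarrow> 'n \<Rightarrow> real) \<Rightarrow> complex \<Rightarrow> complex \<Rightarrow> ('n \<Rightarrow> 'n \<Rightarrow> real) \<Rightarrow> complex" where
  "beta_kernel S V a b X = det_powr_on S X (a - (of_nat (card S) + 1) / 2) *
     det_powr_on S (\<lambda>i j. V i j - X i j) (b - (of_nat (card S) + 1) / 2)"

lemma norm_beta_kernel:
  assumes "\<And>i j. V i j = V j i" "\<And>i j. X i j = X j i"
  shows "complex_of_real (norm (beta_kernel S V a b X)) = beta_kernel S V (of_real (Re a)) (of_real (Re b)) X"
proof -
  have "V i j - X i j = V j i - X j i" for i j using assms[of i j] by simp
  then show ?thesis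
    using assms(2) by (simp add: beta_kernel_def norm_mult norm_det_powr_on)
qed

lemma beta_kernel_cong:
  assumes "\<And>i j. i \<in> S \<Longrightarrow> j \<in> S \<Longrightarrow> V i j = V' i j" "\<And>i j. i \<in> S \<Longrightarrow> j \<in> S \<Longrightarrow> X i j = X' i j"
  shows "beta_kernel S V a b X = beta_kernel S V' a b X'"
  unfolding beta_kernel_def by (intro arg_cong2[where f="(*)"] det_powr_on_cong) (use assms in auto)

lemma beta_kernel_measurable:
  assumes "\<And>i j. i \<in> S \<Longrightarrow> j \<in> S \<Longrightarrow> (\<lambda>x. X x i j) \<in> borel_measurable M"
    and "\<And>x i j. X x i j = X x j i" and "\<And>i j. V i j = V j i"
  shows "(\<lambda>x. beta_kernel S V a b (X x)) \<in> borel_measurable M"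
proof -
  have "V i j - X x i j = V j i - X x j i" for x i j using assms(2)[of x i j] assms(3)[of i j] by simp
  then show ?thesis
    unfolding beta_kernel_def
    by (intro borel_measurable_times det_powr_on_measurable borel_measurable_diff borel_measurable_const)
       (use assms(1,2) in auto)
qed

lemma sym_index_on_coordinate_measurable:
  "i \<in> S \<Longrightarrow> j \<in> S \<Longrightarrow> (\<lambda>x. x {i, j}) \<in> borel_measurable (PiM (sym_index_on S) (\<lambda>_. lborel :: real measure))"
  by (rule measurable_component_singleton[where M="\<lambda>_. lborel", simplified]) (auto simp: sym_index_on_def)

text \<open>Since (m+2)/2 = 1/2 + (m+1)/2, the exponents for size m + 1 are those for size m with a
  and b lowered by 1/2. If 0 < c < d fails, both sides vanish.\<close>

lemma beta_kernel_insert: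
  fixes V X :: "'n::finite \<Rightarrow> 'n \<Rightarrow> real"
  assumes t: "t \<notin> S" and V: "\<And>i j. V i j = V j i" and X: "\<And>i j. X i j = X j i"
  defines "c \<equiv> X t t" and "d \<equiv> V t t"
  shows "beta_kernel (insert t S) V a b X =
    pos_powr c (a - (of_nat (card S) + 2) / 2) * pos_powr (d - c) (b - (of_nat (card S) + 2) / 2) *
    beta_kernel S (\<lambda>i j. schur t V i j - d / (c * (d - c)) * (X t i - c / d * V i t) * (X t j - c / d * V j t))
      (a - 1/2) (b - 1/2) (\<lambda>i j. X i j - X t i * X t j / c)"
proof (cases "c > 0 \<and> d - c > 0")
  case True
  then have p: "c > 0" "d - c > 0" "d > 0" "c \<noteq> 0" "d \<noteq> 0" by auto
  have VX: "V i j - X i j = V j i - X j i" for i j using V[of i j] X[of i j] by simp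
  have e: "z - 1/2 - (of_nat (card S) + 1) / 2 = z - (of_nat (card S) + 2) / (2::complex)"
    "z - (of_nat (card (insert t S)) + 1) / 2 = z - (of_nat (card S) + 2) / (2::complex)" for z :: complex
    using t by (simp_all add: field_simps)
  have s1: "schur t X i j = X i j - X t i * X t j / c" for i j
    unfolding schur_def c_def using X[of i t] by simp
  \<comment> \<open>Completing the square in the row u: the quadratic coefficient is 1/c + 1/(d - c)
    = d/(c (d - c)), and the centre is (c/d) v.\<close>
  have s2: "schur t (\<lambda>i j. V i j - X i j) i j =
    schur t V i j - d / (c * (d - c)) * (X t i - c / d * V i t) * (X t j - c / d * V j t) - (X i j - X t i * X t j / c)" for i j
  proof -
    have "p - x - (v - u) * (v' - u') / (d - c) =
       p - v * v' / d - d / (c * (d - c)) * (u - c / d * v) * (u' - c / d * v') - (x - u * u' / c)" for v v' u u' p x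
    proof -
      define q where "q = d - c"
      have d: "d = c + q" by (simp add: q_def)
      have cq: "c \<noteq> 0" "q \<noteq> 0" "c + q \<noteq> 0" using p by (auto simp: q_def)
      have "d / (c * q) * (u - c / d * v) * (u' - c / d * v') = u * u' * (1 / c + 1 / q) - (u * v' + u' * v) / q + c * v * v' / (q * d)"
        unfolding d using cq by (simp add: divide_simps) (simp add: algebra_simps)
      moreover have "v * v' / d + c * v * v' / (q * d) = v * v' / q"
        unfolding d using cq by (simp add: divide_simps) (simp add: algebra_simps)
      moreover have "(v - u) * (v' - u') / q = v * v' / q + u * u' / q - (u * v' + u' * v) / q"
        using cq by (simp add: field_simps)
      ultimately show ?thesis
        unfolding q_def[symmetric] by (simp add: algebra_simps)
    qed
    from this[of "V i j" "X i j" "V i t" "X t i" "V j t" "X t j"] show ?thesis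
      using V[of j t] X[of i t] by (simp add: schur_def c_def d_def)
  qed
  have s1': "schur t X = (\<lambda>i j. X i j - X t i * X t j / c)"
    by (intro ext s1)
  have s2': "schur t (\<lambda>i j. V i j - X i j) = (\<lambda>i j.
    schur t V i j - d / (c * (d - c)) * (X t i - c / d * V i t) * (X t j - c / d * V j t) - (X i j - X t i * X t j / c))"
    by (intro ext s2)
  show ?thesis
    unfolding beta_kernel_def e
    unfolding det_powr_on_insert[OF t X] det_powr_on_insert[OF t VX] s1' s2' c_def[symmetric] d_def[symmetric]
    by (simp only: mult_ac)
next
  case False
  have VX: "V i j - X i j = V j i - X j i" for i j using V[of i j] X[of i j] by simp
  from False show ?thesis
    unfolding beta_kernel_def
    by (subst det_powr_on_insert[OF t X], subst det_powr_on_insert[OF t VX]) (auto simp: pos_powr_def c_def d_def)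
qed

section \<open>Recurrences of the matrix-variate gamma and beta functions\<close>

lemma mgamma_Suc:
  "mgamma (Suc m) a = of_real (pi powr (of_nat m / 2)) * Gamma a * mgamma m (a - 1/2)"
proof -
  have "real (Suc m) * (real (Suc m) - 1) / 4 = real m / 2 + real m * (real m - 1) / 4"
    by (simp add: field_simps)
  then have 1: "pi powr (real (Suc m) * (real (Suc m) - 1) / 4) = pi powr (real m / 2) * pi powr (real m * (real m - 1) / 4)"
    by (simp only: powr_add)
  have 2: "(\<Prod>i<Suc m. Gamma (a - of_nat i / 2)) = Gamma a * (\<Prod>i<m. Gamma (a - 1/2 - of_nat i / 2))"
    by (subst prod.lessThan_Suc_shift) (simp add: add_divide_distrib diff_diff_eq)
  show ?thesis unfolding mgamma_def 1 2 by simp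
qed

lemma mgamma_0: "mgamma 0 a = 1"
  by (simp add: mgamma_def)

lemma mgamma_nonzero:
  assumes "Re a > (real m - 1) / 2"
  shows "mgamma m a \<noteq> 0"
proof -
  have "Gamma (a - of_nat i / 2) \<noteq> 0" if "i < m" for i
  proof -
    have "real i \<le> real m - 1" using that by linarith
    then have "Re (a - of_nat i / 2) > 0" using assms by (simp add: field_simps)
    from Re_pos_not_nonpos_Int[OF this] show ?thesis by (simp add: Gamma_eq_zero_iff)
  qed
  then show ?thesis by (simp add: mgamma_def)
qed

text \<open>Up to the power of pi, both sides are the product of Gamma at z, z - 1/2, ..., z - m/2,
  with one end factor split off.\<close>

lemma mgamma_half_shift:
  "mgamma m (z - 1/2) * Gamma z = mgamma m z * Gamma (z - of_nat m / 2)"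
proof -
  have "Gamma z * (\<Prod>i<m. Gamma (z - 1/2 - of_nat i / 2)) = (\<Prod>i<Suc m. Gamma (z - of_nat i / 2))"
    by (subst prod.lessThan_Suc_shift) (simp add: add_divide_distrib diff_diff_eq)
  also have "\<dots> = (\<Prod>i<m. Gamma (z - of_nat i / 2)) * Gamma (z - of_nat m / 2)"
    by simp
  finally show ?thesis unfolding mgamma_def by (simp add: mult_ac)
qed

text \<open>The product telescopes, each factor being sqrt pi times a quotient of Gamma values half
  a unit apart.\<close>

lemma prod_Beta_half:
  assumes "m = 0 \<or> Re y > 0"
  shows "(\<Prod>i<m. Beta (1/2) (y + of_nat i / 2)) * Gamma (y + of_nat m / 2)
    = of_real (pi powr (of_nat m / 2)) * Gamma y"
  using assms
proof (induction m)
  case 0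
  then show ?case by simp
next
  case (Suc m)
  then have y: "Re y > 0" by simp
  have "Re (y + of_nat (Suc m) / 2) > 0" using y by (simp add: add_pos_nonneg)
  from Re_pos_not_nonpos_Int[OF this] have "Gamma (y + of_nat (Suc m) / 2) \<noteq> 0"
    by (simp add: Gamma_eq_zero_iff)
  moreover have "1/2 + (y + of_nat m / 2) = y + of_nat (Suc m) / 2" by (simp add: add_divide_distrib)
  ultimately have "Beta (1/2) (y + of_nat m / 2) * Gamma (y + of_nat (Suc m) / 2)
      = of_real (sqrt pi) * Gamma (y + of_nat m / 2)"
    by (simp only: Beta_def Gamma_one_half_complex) simp
  note B = this
  have "(\<Prod>i<Suc m. Beta (1/2) (y + of_nat i / 2)) * Gamma (y + of_nat (Suc m) / 2)
      = (Beta (1/2) (y + of_nat m / 2) * Gamma (y + of_nat (Suc m) / 2)) * (\<Prod>i<m. Beta (1/2) (y + of_nat i / 2))"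
    by (simp only: prod.lessThan_Suc mult_ac)
  also have "\<dots> = of_real (sqrt pi) * ((\<Prod>i<m. Beta (1/2) (y + of_nat i / 2)) * Gamma (y + of_nat m / 2))"
    unfolding B by (simp only: mult_ac)
  also have "\<dots> = of_real (sqrt pi * pi powr (of_nat m / 2)) * Gamma y"
    using Suc.IH y by simp
  also have "sqrt pi * pi powr (of_nat m / 2) = pi powr (of_nat (Suc m) / 2)"
    by (simp add: powr_half_sqrt[symmetric] powr_add[symmetric] add_divide_distrib)
  finally show ?case .
qed

definition matrix_beta :: "nat \<Rightarrow> complex \<Rightarrow> complex \<Rightarrow> complex" where
  "matrix_beta m a b = mgamma m a * mgamma m b / mgamma m (a + b)"

text \<open>The factors are the scalar beta integral in c, the block, and the rank-one integral. The
  last telescopes to pi^(m/2) times a quotient of \<open>mgamma\<close> values that replaces the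
  block's denominator at a + b - 1 by the one at a + b - 1/2, as the recurrence for
  \<open>mgamma (Suc m) (a + b)\<close> demands.\<close>

lemma matrix_beta_Suc:
  assumes a: "Re a > real m / 2" and b: "Re b > real m / 2"
  shows "Beta a b * matrix_beta m (a - 1/2) (b - 1/2) *
      (\<Prod>i<m. Beta (1/2) (a + b - 1 - (of_nat m + 1) / 2 + 1 + of_nat i / 2))
    = matrix_beta (Suc m) a b"
proof -
  define P where "P = (\<Prod>i<m. Beta (1/2) (a + b - 1 - (of_nat m + 1) / 2 + 1 + of_nat i / 2))"
  define p where "p = complex_of_real (pi powr (of_nat m / 2))"
  define z where "z = a + b - 1/2"
  have p: "p \<noteq> 0" by (simp add: p_def)
  have zz: "(a - 1/2) + (b - 1/2) = z - 1/2" by (simp add: z_def)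
  have key: "P * mgamma m z = p * mgamma m (z - 1/2)"
    and nz: "mgamma m z \<noteq> 0" "mgamma m (z - 1/2) \<noteq> 0"
  proof -
    show "P * mgamma m z = p * mgamma m (z - 1/2)"
    \<comment> \<open>For m = 0 the bounds give only Re z > -1/2, so z may be the pole 0 and
      \<open>Gamma z\<close> cannot be cancelled; the identity is then trivial.\<close>
    proof (cases "m = 0")
      case True
      then show ?thesis by (simp add: P_def p_def mgamma_def)
    next
      case False
      then have m: "real m \<ge> 1" by simp
      have y: "a + b - 1 - (of_nat m + 1) / 2 + 1 = z - of_nat m / 2"
        by (simp add: z_def field_simps)
      have "Re (z - of_nat m / 2) > 0" "Re z > 0"
        using a b m by (simp_all add: z_def)
      then have 1: "P * Gamma z = p * Gamma (z - of_nat m / 2)" and "Gamma z \<noteq> 0"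
        using prod_Beta_half[of m "z - of_nat m / 2"] Re_pos_not_nonpos_Int[of z]
        unfolding P_def p_def y by (simp_all add: Gamma_eq_zero_iff)
      moreover have "P * mgamma m z * Gamma z = p * mgamma m (z - 1/2) * Gamma z"
        using mgamma_half_shift[of m z] 1 by (simp add: mult_ac)
      ultimately show ?thesis by simp
    qed
    show "mgamma m z \<noteq> 0" "mgamma m (z - 1/2) \<noteq> 0"
    proof -
      have "m = 0 \<or> real m \<ge> 1" by (cases m) auto
      then show "mgamma m z \<noteq> 0" "mgamma m (z - 1/2) \<noteq> 0"
        using a b by (cases "m = 0"; auto intro!: mgamma_nonzero simp: z_def mgamma_0)+
    qed
  qed
  define X where "X = mgamma m (z - 1/2)"
  define Y where "Y = mgamma m z"
  have XY: "X \<noteq> 0" "Y \<noteq> 0" using nz by (simp_all add: X_def Y_def)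
  have P: "P = p * X / Y"
    using key XY(2) unfolding X_def[symmetric] Y_def[symmetric] by (simp add: eq_divide_eq)
  have "Beta a b * (mgamma m (a - 1/2) * mgamma m (b - 1/2) / X) * P =
     p * Gamma a * mgamma m (a - 1/2) * (p * Gamma b * mgamma m (b - 1/2)) / (p * Gamma (a + b) * Y)"
    unfolding P Beta_def using p XY by simp
  moreover have "a + b - 1/2 = z" by (simp add: z_def)
  ultimately show ?thesis
    unfolding P_def[symmetric] matrix_beta_def mgamma_Suc p_def[symmetric] zz X_def Y_def by simp
qed

text \<open>The pivot is the outermost variable, then the row, then the block. The induction
  generalises over \<open>V\<close>, because the block's upper bound depends on pivot and row, and
  over \<open>a\<close> and \<open>b\<close>, which drop by 1/2 and are also taken at their real
  parts.\<close>

lemma has_bochner_integral_matrix_beta: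
  fixes V :: "'n::finite \<Rightarrow> 'n \<Rightarrow> real"
  assumes "\<And>i j. V i j = V j i"
    and "Re a > (real (card S) - 1) / 2" and "Re b > (real (card S) - 1) / 2"
  shows "has_bochner_integral (PiM (sym_index_on S) (\<lambda>_. lborel)) (\<lambda>x. beta_kernel S V a b (\<lambda>i j. x {i, j}))
    (det_powr_on S V (a + b - (of_nat (card S) + 1) / 2) * matrix_beta (card S) a b)"
  using finite[of S] assms
proof (induction S arbitrary: V a b rule: finite_induct)
  case empty
  have "sym_index_on {} = ({} :: 'n set set)" by (simp add: sym_index_on_def)
  then show ?case
    using has_bochner_integral_PiM_empty[of 1] by (simp add: beta_kernel_def det_powr_on_empty matrix_beta_def mgamma_def)
next
  case (insert t S)
  note t = insert.hyps(2) and sym = insert.prems(1)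
  define R where "R = (\<lambda>i. {t, i}) ` S"
  define Q where "Q = sym_index_on S"
  define m where "m = card S"
  define d where "d = V t t"
  \<comment> \<open>The upper bound that remains for the block once it is translated by u u^T /
    c.\<close>
  define V' where "V' = (\<lambda>c u i j. schur t V i j - d / (c * (d - c)) *
      (u {t, i} - c / d * V i t) * (u {t, j} - c / d * V j t))"
  define f where "f = (\<lambda>a b (x :: 'n set \<Rightarrow> real). beta_kernel (insert t S) V a b (\<lambda>i j. x {i, j}))"
  \<comment> \<open>The exponent given by the induction hypothesis: (a - 1/2) + (b - 1/2) - (m +
    1)/2.\<close>
  define e where "e = (\<lambda>a b :: complex. a + b - 1 - (of_nat m + 1) / 2)"
  define \<alpha> where "\<alpha> = (\<lambda>a :: complex. a - (of_nat m + 2) / 2)"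
  define C where "C = (\<lambda>a b. \<Prod>i<m. Beta (1/2) (e a b + 1 + of_nat i / 2))"
  \<comment> \<open>Everything free of the pivot c after the block and the row are integrated
    out.\<close>
  define K where "K = (\<lambda>a b. cpow d (- (of_nat m / 2)) * matrix_beta m (a - 1/2) (b - 1/2) *
      det_powr_on S (schur t V) (e a b + 1/2) * C a b)"
  define G where "G = (\<lambda>a b c u. pos_powr c (\<alpha> a) * pos_powr (d - c) (\<alpha> b) *
      (det_powr_on S (V' c u) (e a b) * matrix_beta m (a - 1/2) (b - 1/2)))"
  have fin: "finite R" "finite Q" by (simp_all add: R_def Q_def finite_sym_index_on)
  have disj: "R \<inter> Q = {}" "{t} \<notin> R \<union> Q"
    using t by (auto simp: R_def Q_def sym_index_on_def doubleton_eq_iff)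
  have inj: "inj_on (\<lambda>i. {t, i}) S" using t by (auto simp: inj_on_def doubleton_eq_iff)
  have index: "sym_index_on (insert t S) = insert {t} (R \<union> Q)"
    by (simp add: sym_index_on_insert R_def Q_def)
  have fm: "(\<lambda>y. f a b (h y)) \<in> borel_measurable M"
    if "\<And>k. k \<in> sym_index_on (insert t S) \<Longrightarrow> (\<lambda>y. h y k) \<in> borel_measurable M" for a b h and M :: "'z measure"
    unfolding f_def by (intro beta_kernel_measurable sym that) (auto simp: insert_commute sym_index_on_def)
  have nf: "complex_of_real (norm (f a b x)) = f (of_real (Re a)) (of_real (Re b)) x" for a b x
    unfolding f_def by (intro norm_beta_kernel sym) (simp add: insert_commute)
  have f_upd: "f a b ((merge R Q (u, z))({t} := c)) = pos_powr c (\<alpha> a) * pos_powr (d - c) (\<alpha> b) *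
      beta_kernel S (V' c u) (a - 1/2) (b - 1/2) (\<lambda>i j. z {i, j} - u {t, i} * u {t, j} / c)" for a b u z c
  proof -
    let ?X = "\<lambda>i j. ((merge R Q (u, z))({t} := c)) {i, j}"
    have 1: "?X t t = c" by simp
    have 2: "?X t i = u {t, i}" if "i \<in> S" for i
      using that t by (auto simp: R_def merge_def doubleton_eq_iff)
    have 3: "?X i j = z {i, j}" if "i \<in> S" "j \<in> S" for i j
      using that t disj(1) by (auto simp: R_def Q_def merge_def doubleton_eq_iff sym_index_on_def)
    have X: "?X i j = ?X j i" for i j by (simp add: insert_commute)
    show ?thesis
      unfolding f_def beta_kernel_insert[OF t sym X] 1 \<alpha>_def m_def d_def
      by (intro arg_cong2[where f="(*)"] refl beta_kernel_cong) (simp_all only: 2 3 V'_def d_def)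
  qed
  have inner1: "has_bochner_integral (PiM Q (\<lambda>_. lborel)) (\<lambda>z. f a b ((merge R Q (u, z))({t} := c))) (G a b c u)"
    if a: "Re a > real m / 2" and b: "Re b > real m / 2" for a b u c
  proof -
    obtain T where T: "\<And>i j. T {i, j} = u {t, i} * u {t, j} / c"
      using symmetric_lift[of "\<lambda>i j. u {t, i} * u {t, j} / c"] by (auto simp: mult.commute)
    have V'sym: "V' c u i j = V' c u j i" for i j
      unfolding V'_def schur_sym[of V, OF sym, of t i j] by simp
    have "has_bochner_integral (PiM Q (\<lambda>_. lborel)) (\<lambda>z. beta_kernel S (V' c u) (a - 1/2) (b - 1/2) (\<lambda>i j. z {i, j}))
       (det_powr_on S (V' c u) (a - 1/2 + (b - 1/2) - (of_nat (card S) + 1) / 2) * matrix_beta (card S) (a - 1/2) (b - 1/2))"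
      unfolding Q_def by (rule insert.IH[OF V'sym]) (use a b in \<open>auto simp: m_def field_simps\<close>)
    then have "has_bochner_integral (PiM Q (\<lambda>_. lborel)) (\<lambda>z. beta_kernel S (V' c u) (a - 1/2) (b - 1/2) (\<lambda>i j. z {i, j}))
       (det_powr_on S (V' c u) (e a b) * matrix_beta m (a - 1/2) (b - 1/2))"
      by (simp add: e_def m_def algebra_simps)
    from has_bochner_integral_PiM_translate[OF fin(2) this, of "\<lambda>k. - T k"]
    have "has_bochner_integral (PiM Q (\<lambda>_. lborel))
       (\<lambda>z. beta_kernel S (V' c u) (a - 1/2) (b - 1/2) (\<lambda>i j. (\<lambda>k\<in>Q. z k + - T k) {i, j}))
       (det_powr_on S (V' c u) (e a b) * matrix_beta m (a - 1/2) (b - 1/2))" .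
    moreover have "beta_kernel S (V' c u) (a - 1/2) (b - 1/2) (\<lambda>i j. (\<lambda>k\<in>Q. z k + - T k) {i, j}) =
       beta_kernel S (V' c u) (a - 1/2) (b - 1/2) (\<lambda>i j. z {i, j} - u {t, i} * u {t, j} / c)" for z
      by (intro beta_kernel_cong refl) (auto simp: T Q_def sym_index_on_def)
    ultimately show ?thesis
      unfolding f_upd G_def by (intro has_bochner_integral_mult_right) simp
  qed
  have G: "has_bochner_integral (PiM R (\<lambda>_. lborel)) (G a b c) (pos_powr c (a - 1) * pos_powr (d - c) (b - 1) * K a b)"
    if c: "0 < c" "c < d" and a: "Re a > real m / 2" and b: "Re b > real m / 2" for a b c
  proof -
    let ?k = "d / (c * (d - c))"
    have p: "d > 0" "d - c > 0" "c * (d - c) > 0" "?k > 0" using c by simp_all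
    have "Re (e a b) = Re a + Re b - 1 - (real m + 1) / 2" by (simp add: e_def)
    \<comment> \<open>For m \<ge> 1 the bounds give Re e > (m - 3)/2 \<ge> -1; for m = 0 they do
      not, but then there is no row to integrate.\<close>
    moreover have "S = {} \<or> real m \<ge> 1" by (auto simp: m_def Suc_le_eq card_gt_0_iff)
    ultimately have "S = {} \<or> Re (e a b) > - 1" using a b by (auto simp: field_simps)
    then have "has_bochner_integral (PiM R (\<lambda>_. lborel)) (\<lambda>u. det_powr_on S (V' c u) (e a b))
      (det_powr_on S (schur t V) (e a b + 1/2) * cpow ?k (- (of_nat (card S) / 2)) *
        (\<Prod>i<card S. Beta (1/2) (e a b + 1 + of_nat i / 2)))"
      unfolding V'_def R_def
      by (intro has_bochner_integral_det_powr_on_rank_one[where g = "\<lambda>i. {t, i}" and a = "\<lambda>i. c / d * V i t"]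
          inj schur_sym sym p)
    then have J: "has_bochner_integral (PiM R (\<lambda>_. lborel)) (G a b c)
      (pos_powr c (\<alpha> a) * pos_powr (d - c) (\<alpha> b) * (det_powr_on S (schur t V) (e a b + 1/2) * cpow ?k (- (of_nat m / 2)) *
         C a b * matrix_beta m (a - 1/2) (b - 1/2)))"
      unfolding G_def C_def m_def
      by (intro has_bochner_integral_mult_right has_bochner_integral_mult_left)
    \<comment> \<open>The coefficient to the power -m/2 supplies c^(m/2) (d - c)^(m/2), which raises
      the pivot exponents to a - 1 and b - 1, those of the scalar beta integral.\<close>
    have "cpow c (\<alpha> a) * cpow (d - c) (\<alpha> b) * cpow ?k (- (of_nat m / 2)) =
       cpow c (a - 1) * cpow (d - c) (b - 1) * cpow d (- (of_nat m / 2))"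
    proof -
      have 1: "cpow x (\<alpha> w) = cpow x (w - 1) * cpow x (- (of_nat m / 2))" if "x > 0" for x w
      proof -
        have "\<alpha> w = (w - 1) + - (of_nat m / 2)" by (simp add: \<alpha>_def field_simps)
        then show ?thesis by (simp only: cpow_add[OF that])
      qed
      show ?thesis
        unfolding 1[OF c(1)] 1[OF p(2)] cpow_divide[OF p(1,3)] cpow_mult[OF c(1) p(2)]
        using cpow_nonzero[OF c(1)] cpow_nonzero[OF p(2)] by (simp add: field_simps)
    qed
    then have mid: "pos_powr c (\<alpha> a) * pos_powr (d - c) (\<alpha> b) * cpow ?k (- (of_nat m / 2)) =
       pos_powr c (a - 1) * pos_powr (d - c) (b - 1) * cpow d (- (of_nat m / 2))"
      using c by (simp add: pos_powr_def)
    have "pos_powr c (\<alpha> a) * pos_powr (d - c) (\<alpha> b) * (det_powr_on S (schur t V) (e a b + 1/2) * cpow ?k (- (of_nat m / 2)) *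
         C a b * matrix_beta m (a - 1/2) (b - 1/2)) =
       pos_powr c (\<alpha> a) * pos_powr (d - c) (\<alpha> b) * (det_powr_on S (schur t V) (e a b + 1/2) * cpow ?k (- (of_nat m / 2)) *
         (C a b * matrix_beta m (a - 1/2) (b - 1/2)))"
      by (simp only: mult.assoc)
    also have "\<dots> = pos_powr c (a - 1) * pos_powr (d - c) (b - 1) * K a b"
      unfolding mult_mid_cong[OF mid] K_def by (simp only: mult_ac)
    finally have "pos_powr c (\<alpha> a) * pos_powr (d - c) (\<alpha> b) * (det_powr_on S (schur t V) (e a b + 1/2) * cpow ?k (- (of_nat m / 2)) *
         C a b * matrix_beta m (a - 1/2) (b - 1/2)) = pos_powr c (a - 1) * pos_powr (d - c) (b - 1) * K a b" .
    with J show ?thesis by simp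
  qed
  have inner2: "has_bochner_integral (PiM (R \<union> Q) (\<lambda>_. lborel)) (\<lambda>y. f a b (y({t} := c)))
      (pos_powr c (a - 1) * pos_powr (d - c) (b - 1) * K a b)"
    if a: "Re a > real m / 2" and b: "Re b > real m / 2" for a b c
  proof (cases "0 < c \<and> c < d")
    case True
    then have c: "0 < c" "c < d" by auto
    let ?a = "complex_of_real (Re a)" and ?b = "complex_of_real (Re b)"
    show ?thesis
    proof (rule has_bochner_integral_PiM_Un[OF fin disj(1)])
      show "(\<lambda>y. f a b (y({t} := c))) \<in> borel_measurable (PiM (R \<union> Q) (\<lambda>_. lborel))"
      proof (rule fm)
        fix k assume "k \<in> sym_index_on (insert t S)"
        then have "k = {t} \<or> k \<in> R \<union> Q" unfolding index by simp
        then show "(\<lambda>y. (y({t} := c)) k) \<in> borel_measurable (PiM (R \<union> Q) (\<lambda>_. lborel))"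
          using disj(2) measurable_component_singleton[of k "R \<union> Q" "\<lambda>_. lborel"] by fastforce
      qed
      show "has_bochner_integral (PiM Q (\<lambda>_. lborel)) (\<lambda>y. f a b ((merge R Q (x, y))({t} := c))) (G a b c x)" for x
        by (rule inner1[OF a b])
      show "has_bochner_integral (PiM Q (\<lambda>_. lborel)) (\<lambda>y. complex_of_real (norm (f a b ((merge R Q (x, y))({t} := c)))))
        (G ?a ?b c x)" for x
        unfolding nf by (rule inner1) (use a b in auto)
      show "integrable (PiM R (\<lambda>_. lborel)) (G ?a ?b c)"
        using G[OF c, of ?a ?b] a b by (simp add: has_bochner_integral_iff)
      show "has_bochner_integral (PiM R (\<lambda>_. lborel)) (G a b c) (pos_powr c (a - 1) * pos_powr (d - c) (b - 1) * K a b)"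
        by (rule G[OF c a b])
    qed
  next
    \<comment> \<open>Here the rank-one coefficient need not be positive, but the kernel vanishes
      identically.\<close>
    case False
    have "f a b (y({t} := c)) = 0" for y
    proof -
      have X: "(y({t} := c)) {i, j} = (y({t} := c)) {j, i}" for i j by (simp add: insert_commute)
      show ?thesis
        unfolding f_def beta_kernel_insert[OF t sym X] using False by (auto simp: pos_powr_def d_def)
    qed
    moreover have "pos_powr c (a - 1) * pos_powr (d - c) (b - 1) * K a b = 0"
      using False by (auto simp: pos_powr_def)
    ultimately show ?thesis by (simp only: has_bochner_integral_zero)
  qed
  have a: "Re a > real m / 2" and b: "Re b > real m / 2"
    using insert by (auto simp: m_def)
  let ?a = "complex_of_real (Re a)" and ?b = "complex_of_real (Re b)"
  have m0: "real m / 2 \<ge> 0" by simp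
  have ab: "Re a > 0" "Re b > 0" using a b m0 by linarith+
  have "has_bochner_integral (PiM (insert {t} (R \<union> Q)) (\<lambda>_. lborel)) (f a b) (pos_powr d (a + b - 1) * Beta a b * K a b)"
  proof (rule has_bochner_integral_PiM_insert[OF _ disj(2)])
    show "f a b \<in> borel_measurable (PiM (insert {t} (R \<union> Q)) (\<lambda>_. lborel))"
      using fm[of "\<lambda>y. y" "PiM (insert {t} (R \<union> Q)) (\<lambda>_. lborel)" a b] 
        measurable_component_singleton[of _ "insert {t} (R \<union> Q)" "\<lambda>_. lborel :: real measure"]
      unfolding index by simp
    show "has_bochner_integral (PiM (R \<union> Q) (\<lambda>_. lborel)) (\<lambda>y. f a b (y({t} := c)))
      (pos_powr c (a - 1) * pos_powr (d - c) (b - 1) * K a b)" for c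
      by (rule inner2[OF a b])
    show "has_bochner_integral (PiM (R \<union> Q) (\<lambda>_. lborel)) (\<lambda>y. complex_of_real (norm (f a b (y({t} := c)))))
      (pos_powr c (?a - 1) * pos_powr (d - c) (?b - 1) * K ?a ?b)" for c
      unfolding nf by (rule inner2) (use a b in auto)
    show "integrable lborel (\<lambda>c. pos_powr c (?a - 1) * pos_powr (d - c) (?b - 1) * K ?a ?b)"
      using has_bochner_integral_pos_powr_convolution[of ?a ?b d] ab
      by (intro integrable_mult_left) (simp add: has_bochner_integral_iff)
    show "has_bochner_integral lborel (\<lambda>c. pos_powr c (a - 1) * pos_powr (d - c) (b - 1) * K a b)
      (pos_powr d (a + b - 1) * Beta a b * K a b)"
      by (intro has_bochner_integral_mult_left has_bochner_integral_pos_powr_convolution ab)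
  qed (use fin in simp)
  moreover have "pos_powr d (a + b - 1) * Beta a b * K a b =
     det_powr_on (insert t S) V (a + b - (of_nat (card (insert t S)) + 1) / 2) * matrix_beta (card (insert t S)) a b"
  proof (cases "d > 0")
    case True
    have ex: "a + b - (of_nat (card (insert t S)) + 1) / 2 = e a b + 1/2"
      "a + b - 1 + - (of_nat m / 2) = e a b + 1/2"
      using t by (simp_all add: e_def m_def field_simps)
    have "cpow d (a + b - 1) * cpow d (- (of_nat m / 2)) = cpow d (e a b + 1/2)"
      by (simp only: cpow_add[OF True, symmetric] ex)
    then have 1: "pos_powr d (a + b - 1) * cpow d (- (of_nat m / 2)) = pos_powr d (e a b + 1/2)"
      using True by (simp add: pos_powr_def)
    have 2: "Beta a b * matrix_beta m (a - 1/2) (b - 1/2) * C a b = matrix_beta (card (insert t S)) a b"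
      using matrix_beta_Suc[OF a b] t by (simp only: C_def e_def m_def) simp
    have "pos_powr d (a + b - 1) * Beta a b * K a b = (pos_powr d (a + b - 1) * cpow d (- (of_nat m / 2))) *
        det_powr_on S (schur t V) (e a b + 1/2) * (Beta a b * matrix_beta m (a - 1/2) (b - 1/2) * C a b)"
      unfolding K_def by (simp only: mult_ac)
    also have "\<dots> = det_powr_on (insert t S) V (e a b + 1/2) * matrix_beta (card (insert t S)) a b"
      unfolding 1 2 det_powr_on_insert[OF t sym] d_def[symmetric] ..
    finally show ?thesis unfolding ex .
  next
    case False
    then show ?thesis
      unfolding det_powr_on_insert[OF t sym] by (simp add: pos_powr_def d_def)
  qed
  ultimately show ?case by (simp add: f_def index)
qed

section \<open>The M-transform of the Kober operator\<close>

definition sym_det_powr :: "('n::finite set \<Rightarrow> real) \<Rightarrow> complex \<Rightarrow> complex" where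
  "sym_det_powr x z = det_powr_on UNIV (\<lambda>i j. x {i, j}) z"

lemma sym_det_powr_eq: "sym_det_powr x z = (if posdef (symm x) then cpow (det (symm x)) z else 0)"
  using posdef_on_UNIV[of "symm x"] det_on_UNIV[of "symm x"] by (simp add: sym_det_powr_def det_powr_on_def symm_def)

lemma symm_diff: "symm x - symm y = symm (\<lambda>k. x k - y k)"
  by (simp add: symm_def vec_eq_iff)

text \<open>Positive definite matrices are closed under addition; hence U > O and V > U place V in
  the cone on which the M-transform of f is taken.\<close>

lemma posdef_symm_trans:
  fixes x y :: "'n::finite set \<Rightarrow> real"
  assumes "posdef (symm x)" "posdef (symm y - symm x)"
  shows "posdef (symm y)"
  using posdef_on_add[of UNIV "\<lambda>i j. symm x $ i $ j" "\<lambda>i j. (symm y - symm x) $ i $ j"] assms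
    posdef_on_UNIV[of "symm x"] posdef_on_UNIV[of "symm y - symm x"] posdef_on_UNIV[of "symm y"]
  by simp

lemma norm_sym_det_powr: "complex_of_real (norm (sym_det_powr x z)) = sym_det_powr x (of_real (Re z))"
  unfolding sym_det_powr_def by (rule norm_det_powr_on) (simp add: insert_commute)

lemma det_symm_pos:
  fixes x :: "'n::finite set \<Rightarrow> real"
  assumes "posdef (symm x)"
  shows "det (symm x) > 0"
proof -
  have "posdef_on UNIV (\<lambda>i j. symm x $ i $ j)" using assms posdef_on_UNIV[of "symm x"] by simp
  from det_on_pos[OF _ this] show ?thesis
    using det_on_UNIV[of "symm x"] by (simp add: symm_def insert_commute)
qed

lemma has_bochner_integral_sym_beta:
  fixes v :: "'n::finite set \<Rightarrow> real"
  assumes "Re a > (real CARD('n) - 1) / 2" "Re b > (real CARD('n) - 1) / 2"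
  shows "has_bochner_integral sym_meas
    (\<lambda>u. sym_det_powr u (a - (of_nat CARD('n) + 1) / 2) * sym_det_powr (\<lambda>k. v k - u k) (b - (of_nat CARD('n) + 1) / 2))
    (sym_det_powr v (a + b - (of_nat CARD('n) + 1) / 2) * matrix_beta CARD('n) a b)"
  using has_bochner_integral_matrix_beta[of "\<lambda>i j. v {i, j}" UNIV a b] assms
  by (simp add: insert_commute sym_det_powr_def sym_meas_def sym_index_on_UNIV beta_kernel_def)

section \<open>Product measure over the k matrices\<close>

lemma sigma_finite_sym_meas: "sigma_finite_measure (sym_meas :: ('n::finite set \<Rightarrow> real) measure)"
  unfolding sym_meas_def by (rule sigma_finite_PiM_lborel) (simp flip: sym_index_on_UNIV add: finite_sym_index_on)

lemma product_sigma_finite_sym_meas: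
  "product_sigma_finite (\<lambda>_. sym_meas :: ('n::finite set \<Rightarrow> real) measure)"
  by (intro product_sigma_finite.intro sigma_finite_sym_meas)

lemma sigma_finite_multi_meas:
  "sigma_finite_measure (multi_meas k :: (nat \<Rightarrow> 'n::finite set \<Rightarrow> real) measure)"
  unfolding multi_meas_def
  by (rule product_sigma_finite.sigma_finite[OF product_sigma_finite_sym_meas]) simp

lemma has_bochner_integral_multi_prod:
  fixes g :: "nat \<Rightarrow> ('n::finite set \<Rightarrow> real) \<Rightarrow> complex"
  assumes "\<And>j. j < k \<Longrightarrow> has_bochner_integral sym_meas (g j) (r j)"
  shows "has_bochner_integral (multi_meas k) (\<lambda>U. \<Prod>j<k. g j (U j)) (\<Prod>j<k. r j)"
proof -
  interpret product_sigma_finite "\<lambda>_::nat. sym_meas :: ('n set \<Rightarrow> real) measure"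
    by (rule product_sigma_finite_sym_meas)
  have "integrable (multi_meas k) (\<lambda>U. \<Prod>j<k. g j (U j))"
    unfolding multi_meas_def
    by (rule product_integrable_prod) (use assms in \<open>auto simp: has_bochner_integral_iff\<close>)
  moreover have "integral\<^sup>L (multi_meas k) (\<lambda>U. \<Prod>j<k. g j (U j)) = (\<Prod>j<k. integral\<^sup>L sym_meas (g j))"
    unfolding multi_meas_def
    by (rule product_integral_prod) (use assms in \<open>auto simp: has_bochner_integral_iff\<close>)
  moreover have "(\<Prod>j<k. integral\<^sup>L sym_meas (g j)) = (\<Prod>j<k. r j)"
    using assms by (intro prod.cong) (auto simp: has_bochner_integral_iff)
  ultimately show ?thesis by (simp add: has_bochner_integral_iff)
qed

lemma multi_coordinate_measurable:
  assumes "j < k"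
  shows "(\<lambda>U. U j {i, l}) \<in> borel_measurable (multi_meas k :: (nat \<Rightarrow> 'n::finite set \<Rightarrow> real) measure)"
proof -
  have 1: "(\<lambda>U. U j) \<in> measurable (multi_meas k) (sym_meas :: ('n set \<Rightarrow> real) measure)"
    unfolding multi_meas_def using assms by (intro measurable_component_singleton) simp
  have "(\<lambda>x. x {i, l}) \<in> borel_measurable (sym_meas :: ('n set \<Rightarrow> real) measure)"
    unfolding sym_meas_def sym_index_on_UNIV[symmetric] by (rule sym_index_on_coordinate_measurable) auto
  with 1 show ?thesis by (rule measurable_compose)
qed

theorem theorem5p2:
  fixes k :: nat
    and f :: "(nat \<Rightarrow> 'n::finite set \<Rightarrow> real) \<Rightarrow> real"
    and \<zeta> \<alpha> s :: "nat \<Rightarrow> complex"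
  assumes "k \<ge> 1"
    and "set_integrable (multi_meas k) (multi_pos k)
           (\<lambda>V. M_kernel k s V * complex_of_real (f V))"
    and "\<And>j. j < k \<Longrightarrow> Re (\<alpha> j) > (real CARD('n) - 1) / 2"
    and "\<And>j. j < k \<Longrightarrow> Re (\<zeta> j + s j) > (real CARD('n) - 1) / 2"
  shows "M_transform k (kober2 k \<zeta> \<alpha> f) s =
         M_transform k (\<lambda>V. complex_of_real (f V)) s *
         (\<Prod>j<k. mgamma CARD('n) (\<zeta> j + s j) / mgamma CARD('n) (\<alpha> j + \<zeta> j + s j))"
proof -
  let ?M = "multi_meas k :: (nat \<Rightarrow> 'n set \<Rightarrow> real) measure"
  let ?p = "CARD('n)"
  define h where "h = (of_nat ?p + 1) / (2 :: complex)"
  \<comment> \<open>The integrand of the M-transform of f, the only form in which f is known to be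
    integrable.\<close>
  define \<Phi> where "\<Phi> V = indicator (multi_pos k) V *\<^sub>R (M_kernel k s V * complex_of_real (f V))" for V
  define c where "c = (\<Prod>j<k. 1 / mgamma ?p (\<alpha> j))"
  define P where "P a b V U = (\<Prod>j<k. sym_det_powr (U j) (a j - h) * sym_det_powr (\<lambda>i. V j i - U j i) (b j - h))"
    for a b :: "nat \<Rightarrow> complex" and V U :: "nat \<Rightarrow> 'n set \<Rightarrow> real"
  \<comment> \<open>The Kober power |V|^(-\<zeta>-\<alpha>) divided by the kernel |V|^(s-h)
    contained in \<open>\<Phi>\<close>. With a = \<zeta> + s and b = \<alpha> it is the inverse of
    the power produced by the beta integral.\<close>
  define Q where "Q a b V = (\<Prod>j<k. sym_det_powr (V j) (- (a j + b j - h)))"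
    for a b :: "nat \<Rightarrow> complex" and V :: "nat \<Rightarrow> 'n set \<Rightarrow> real"
  define B where "B a b = (\<Prod>j<k. matrix_beta ?p (a j) (b j))" for a b
  define H where "H V U = P (\<lambda>j. \<zeta> j + s j) \<alpha> V U * (Q (\<lambda>j. \<zeta> j + s j) \<alpha> V * \<Phi> V * c)" for V U
  define a' where "a' j = complex_of_real (Re (\<zeta> j + s j))" for j
  define b' where "b' j = complex_of_real (Re (\<alpha> j))" for j
  have \<Phi>: "integrable ?M \<Phi>"
    using assms(2) unfolding set_integrable_def \<Phi>_def .
  have P: "has_bochner_integral ?M (P a b V) (B a b * (\<Prod>j<k. sym_det_powr (V j) (a j + b j - h)))"
    if "\<And>j. j < k \<Longrightarrow> Re (a j) > (real ?p - 1) / 2" "\<And>j. j < k \<Longrightarrow> Re (b j) > (real ?p - 1) / 2" for a b V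
  proof -
    have "has_bochner_integral ?M (\<lambda>U. \<Prod>j<k. sym_det_powr (U j) (a j - h) * sym_det_powr (\<lambda>i. V j i - U j i) (b j - h))
       (\<Prod>j<k. sym_det_powr (V j) (a j + b j - h) * matrix_beta ?p (a j) (b j))"
      unfolding h_def
      by (rule has_bochner_integral_multi_prod[where g = "\<lambda>j u. sym_det_powr u (a j - (of_nat ?p + 1) / 2) *
            sym_det_powr (\<lambda>i. V j i - u i) (b j - (of_nat ?p + 1) / 2)"])
         (intro has_bochner_integral_sym_beta that)
    then show ?thesis by (simp add: P_def[abs_def] B_def prod.distrib mult.commute)
  qed
  \<comment> \<open>Inverse powers cancel on the positive cone only; off it \<open>\<Phi>\<close> is
    0, which is the alternative x = 0.\<close>
  have Q: "(\<Prod>j<k. sym_det_powr (V j) (a j + b j - h)) * (Q a b V * x) = x" if "x = 0 \<or> V \<in> multi_pos k" for a b V x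
  proof (cases "x = 0")
    case False
    then have "V \<in> multi_pos k" using that by simp
    then have "(\<Prod>j<k. sym_det_powr (V j) (a j + b j - h) * sym_det_powr (V j) (- (a j + b j - h))) = 1"
      by (intro prod.neutral)
        (auto simp: multi_pos_def sym_det_powr_eq cpow_minus cpow_nonzero det_symm_pos simp del: minus_diff_eq)
    then show ?thesis by (simp add: Q_def prod.distrib mult.assoc[symmetric])
  qed simp
  have \<Phi>0: "\<Phi> V * x = 0 \<or> V \<in> multi_pos k" for V x by (auto simp: \<Phi>_def indicator_def)
  have inner: "has_bochner_integral ?M (\<lambda>U. P a b V U * (Q a b V * x)) (B a b * x)"
    if "\<And>j. j < k \<Longrightarrow> Re (a j) > (real ?p - 1) / 2" "\<And>j. j < k \<Longrightarrow> Re (b j) > (real ?p - 1) / 2"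
      and x: "x = 0 \<or> V \<in> multi_pos k" for a b V x
  proof -
    have "has_bochner_integral ?M (\<lambda>U. P a b V U * (Q a b V * x))
        ((B a b * (\<Prod>j<k. sym_det_powr (V j) (a j + b j - h))) * (Q a b V * x))"
      by (intro has_bochner_integral_mult_left P that(1,2))
    then show ?thesis by (simp only: mult.assoc Q[OF x])
  qed
  have normP: "complex_of_real (norm (P (\<lambda>j. \<zeta> j + s j) \<alpha> V U)) = P a' b' V U" for V U
    unfolding P_def a'_def b'_def
    by (simp add: prod_norm[symmetric] norm_mult norm_sym_det_powr h_def)
  have normQ: "complex_of_real (norm (Q (\<lambda>j. \<zeta> j + s j) \<alpha> V)) = Q a' b' V" for V
    unfolding Q_def a'_def b'_def
    by (simp add: prod_norm[symmetric] norm_sym_det_powr h_def)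
  have meas: "case_prod H \<in> borel_measurable (?M \<Otimes>\<^sub>M ?M)"
  proof -
    have [measurable]: "(\<lambda>x. fst x j {i, l}) \<in> borel_measurable (?M \<Otimes>\<^sub>M ?M)"
      "(\<lambda>x. snd x j {i, l}) \<in> borel_measurable (?M \<Otimes>\<^sub>M ?M)" if "j < k" for i j l
      using multi_coordinate_measurable[OF that, of i l] by measurable
    have 1: "(\<lambda>x. sym_det_powr (fst x j) z) \<in> borel_measurable (?M \<Otimes>\<^sub>M ?M)"
      "(\<lambda>x. sym_det_powr (snd x j) z) \<in> borel_measurable (?M \<Otimes>\<^sub>M ?M)"
      "(\<lambda>x. sym_det_powr (\<lambda>i. fst x j i - snd x j i) z) \<in> borel_measurable (?M \<Otimes>\<^sub>M ?M)" if "j < k" for j z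
      unfolding sym_det_powr_def using that by (auto intro!: det_powr_on_measurable simp: insert_commute)
    have "(\<lambda>x. P (\<lambda>j. \<zeta> j + s j) \<alpha> (fst x) (snd x) * (Q (\<lambda>j. \<zeta> j + s j) \<alpha> (fst x) * \<Phi> (fst x) * c))
        \<in> borel_measurable (?M \<Otimes>\<^sub>M ?M)"
      unfolding P_def Q_def
      using borel_measurable_integrable[OF \<Phi>]
      by (intro borel_measurable_times borel_measurable_prod 1 borel_measurable_const
          measurable_compose[OF measurable_fst]) auto
    then show ?thesis by (simp add: H_def case_prod_beta')
  qed
  have psf: "pair_sigma_finite ?M ?M"
    by (intro pair_sigma_finite.intro sigma_finite_multi_meas)
  have int: "has_bochner_integral (?M \<Otimes>\<^sub>M ?M) (case_prod H)
      (integral\<^sup>L ?M \<Phi> * (B (\<lambda>j. \<zeta> j + s j) \<alpha> * c))"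
  proof (rule has_bochner_integral_pair[OF psf meas])
    show "has_bochner_integral ?M (\<lambda>U. case_prod H (V, U)) (\<Phi> V * (B (\<lambda>j. \<zeta> j + s j) \<alpha> * c))" for V
      using inner[where V = V and x = "\<Phi> V * c", OF assms(4,3) \<Phi>0] by (simp add: H_def mult_ac)
    have nH: "complex_of_real (norm (case_prod H (V, U))) =
        P a' b' V U * (Q a' b' V * of_real (norm (\<Phi> V * c)))" for V U
      by (simp add: H_def norm_mult normP[symmetric] normQ[symmetric])
    show "has_bochner_integral ?M (\<lambda>U. complex_of_real (norm (case_prod H (V, U))))
        (B a' b' * of_real (norm (\<Phi> V * c)))" for V
      unfolding nH by (rule inner) (use assms(3,4) \<Phi>0[of V c] in \<open>auto simp: a'_def b'_def\<close>)
    show "integrable ?M (\<lambda>V. B a' b' * of_real (norm (\<Phi> V * c)))"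
      using \<Phi> by (intro integrable_mult_right integrable_of_real integrable_norm integrable_mult_left)
    show "has_bochner_integral ?M (\<lambda>V. \<Phi> V * (B (\<lambda>j. \<zeta> j + s j) \<alpha> * c))
       (integral\<^sup>L ?M \<Phi> * (B (\<lambda>j. \<zeta> j + s j) \<alpha> * c))"
      using \<Phi> by (intro has_bochner_integral_mult_left) (simp add: has_bochner_integral_iff)
  qed
  \<comment> \<open>The integrands agree pointwise, so this also covers any U whose V-integral
    diverges: both sides then take the default value 0.\<close>
  have fibre: "indicator (multi_pos k) U *\<^sub>R (M_kernel k s U * kober2 k \<zeta> \<alpha> f U) = (\<integral>V. H V U \<partial>?M)"
    if U: "U \<in> space ?M" for U
  proof (cases "U \<in> multi_pos k")
    case False
    then obtain j where j: "j < k" "\<not> posdef (symm (U j))" using U by (auto simp: multi_pos_def)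
    have "P (\<lambda>j. \<zeta> j + s j) \<alpha> V U = 0" for V
      unfolding P_def by (rule prod_zero) (use j in \<open>auto simp: sym_det_powr_eq\<close>)
    then show ?thesis using False by (simp add: H_def)
  next
    case True
    then have pU: "posdef (symm (U j))" if "j < k" for j using that by (auto simp: multi_pos_def)
    let ?A = "{V \<in> space ?M. \<forall>j<k. posdef (symm (V j) - symm (U j))}"
    let ?g = "\<lambda>V. (\<Prod>j<k. cpow (det (symm (V j))) (- \<zeta> j - \<alpha> j) *
                 cpow (det (symm (V j) - symm (U j))) (\<alpha> j - (of_nat CARD('n) + 1) / 2))
        * complex_of_real (f V)"
    let ?C = "M_kernel k s U * (\<Prod>j<k. cpow (det (symm (U j))) (\<zeta> j) / mgamma CARD('n) (\<alpha> j))"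
    have "H V U = ?C * (indicator ?A V *\<^sub>R ?g V)" if V: "V \<in> space ?M" for V
    proof (cases "V \<in> ?A")
      case False
      then obtain j where j: "j < k" "\<not> posdef (symm (V j) - symm (U j))" using V by auto
      have "P (\<lambda>j. \<zeta> j + s j) \<alpha> V U = 0"
        unfolding P_def by (rule prod_zero) (use j in \<open>auto simp: sym_det_powr_eq symm_diff\<close>)
      then show ?thesis using False by (simp add: H_def)
    next
      case VA: True
      then have pVU: "posdef (symm (V j) - symm (U j))" if "j < k" for j using that by auto
      then have pV: "posdef (symm (V j))" if "j < k" for j
        using posdef_symm_trans pU that by blast
      then have Vpos: "V \<in> multi_pos k" using V by (auto simp: multi_pos_def)
      have P1: "P (\<lambda>j. \<zeta> j + s j) \<alpha> V U = (\<Prod>j<k. cpow (det (symm (U j))) (\<zeta> j + s j - h) *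
          cpow (det (symm (V j) - symm (U j))) (\<alpha> j - h))"
        using pU pVU by (simp add: P_def sym_det_powr_eq symm_diff[symmetric])
      have Q1: "Q (\<lambda>j. \<zeta> j + s j) \<alpha> V = (\<Prod>j<k. cpow (det (symm (V j))) (- (\<zeta> j + s j + \<alpha> j - h)))"
        using pV by (simp add: Q_def sym_det_powr_eq)
      have \<Phi>1: "\<Phi> V = (\<Prod>j<k. cpow (det (symm (V j))) (s j - h)) * f V"
        using Vpos by (simp add: \<Phi>_def M_kernel_def h_def)
      have "H V U = (\<Prod>j<k. (cpow (det (symm (U j))) (\<zeta> j + s j - h) * cpow (det (symm (V j) - symm (U j))) (\<alpha> j - h)) *
          (cpow (det (symm (V j))) (- (\<zeta> j + s j + \<alpha> j - h)) * cpow (det (symm (V j))) (s j - h)) *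
          (1 / mgamma ?p (\<alpha> j))) * f V"
        unfolding H_def P1 Q1 \<Phi>1 c_def by (simp only: prod.distrib mult_ac)
      also have "\<dots> = (\<Prod>j<k. cpow (det (symm (U j))) (s j - h) * (cpow (det (symm (U j))) (\<zeta> j) / mgamma ?p (\<alpha> j)) *
           (cpow (det (symm (V j))) (- \<zeta> j - \<alpha> j) * cpow (det (symm (V j) - symm (U j))) (\<alpha> j - h))) * f V"
      proof (rule arg_cong2[where f="(*)", OF prod.cong[OF refl] refl])
        fix j assume "j \<in> {..<k}"
        then have j: "j < k" by simp
        have 1: "cpow (det (symm (V j))) (- (\<zeta> j + s j + \<alpha> j - h)) * cpow (det (symm (V j))) (s j - h)
            = cpow (det (symm (V j))) (- \<zeta> j - \<alpha> j)"
        proof -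
          have "- (\<zeta> j + s j + \<alpha> j - h) + (s j - h) = - \<zeta> j - \<alpha> j" by (simp add: algebra_simps)
          then show ?thesis by (simp only: cpow_add[OF det_symm_pos[OF pV[OF j]], symmetric])
        qed
        have 2: "cpow (det (symm (U j))) (\<zeta> j + s j - h) = cpow (det (symm (U j))) (s j - h) * cpow (det (symm (U j))) (\<zeta> j)"
          by (simp add: cpow_add[OF det_symm_pos[OF pU[OF j]], symmetric] algebra_simps)
        show "(cpow (det (symm (U j))) (\<zeta> j + s j - h) * cpow (det (symm (V j) - symm (U j))) (\<alpha> j - h)) *
          (cpow (det (symm (V j))) (- (\<zeta> j + s j + \<alpha> j - h)) * cpow (det (symm (V j))) (s j - h)) *
          (1 / mgamma ?p (\<alpha> j)) = cpow (det (symm (U j))) (s j - h) * (cpow (det (symm (U j))) (\<zeta> j) / mgamma ?p (\<alpha> j)) *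
           (cpow (det (symm (V j))) (- \<zeta> j - \<alpha> j) * cpow (det (symm (V j) - symm (U j))) (\<alpha> j - h))"
          unfolding 1 2 by simp
      qed
      also have "\<dots> = ?C * ?g V"
        unfolding M_kernel_def h_def[symmetric] by (simp only: prod.distrib mult_ac)
      finally show ?thesis using VA by simp
    qed
    then have "(\<integral>V. H V U \<partial>?M) = (\<integral>V. ?C * (indicator ?A V *\<^sub>R ?g V) \<partial>?M)"
      by (intro Bochner_Integration.integral_cong refl)
    also have "\<dots> = ?C * (LINT V : ?A | ?M. ?g V)"
      unfolding set_lebesgue_integral_def by (rule integral_mult_right_zero)
    finally show ?thesis
      using True by (simp add: kober2_def)
  qed
  have "M_transform k (kober2 k \<zeta> \<alpha> f) s = (\<integral>U. (\<integral>V. H V U \<partial>?M) \<partial>?M)"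
    unfolding M_transform_def set_lebesgue_integral_def
    by (intro Bochner_Integration.integral_cong refl fibre)
  \<comment> \<open>The pair integral was evaluated with U innermost; the transform of the Kober
    operator is the same integral with V innermost.\<close>
  also have "\<dots> = integral\<^sup>L ?M \<Phi> * (B (\<lambda>j. \<zeta> j + s j) \<alpha> * c)"
    using pair_sigma_finite.integral_snd[OF psf, of H] int by (simp add: has_bochner_integral_iff)
  also have "integral\<^sup>L ?M \<Phi> = M_transform k (\<lambda>V. complex_of_real (f V)) s"
    by (simp add: M_transform_def set_lebesgue_integral_def \<Phi>_def[abs_def])
  also have "B (\<lambda>j. \<zeta> j + s j) \<alpha> * c =
      (\<Prod>j<k. mgamma CARD('n) (\<zeta> j + s j) / mgamma CARD('n) (\<alpha> j + \<zeta> j + s j))"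
    unfolding B_def c_def prod.distrib[symmetric]
  proof (intro prod.cong refl)
    fix j assume "j \<in> {..<k}"
    then have "mgamma ?p (\<alpha> j) \<noteq> 0" using assms(3) by (intro mgamma_nonzero) simp
    then show "matrix_beta ?p (\<zeta> j + s j) (\<alpha> j) * (1 / mgamma ?p (\<alpha> j)) =
        mgamma ?p (\<zeta> j + s j) / mgamma ?p (\<alpha> j + \<zeta> j + s j)"
      by (simp add: matrix_beta_def add_ac)
  qed
  finally show ?thesis .
qed

end
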